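(* Let $P,f,\mathfrak K,M,K,\alpha,\beta,r,\sigma,z_i,w_i,Y,W$ and the decompositions $M_1=M_{1,1}\oplus M_{1,2}$, $M_3=M_{3,1}\oplus M_{3,2}$ be the data fixed in the context. Suppose that $X:M_1\to M_2$ is a $P$-module homomorphism which satisfies (a) $X\circ\alpha_1=0$, (b) $m_2\circ X=\beta_0(1)\cdot \mathrm{id}_{M_1}-\alpha_1\circ\beta_1$, (c) $X\circ m_2+m_3\circ X^\dagger=\beta_0(1)\cdot\mathrm{id}_{M_2}-\alpha_2\circ\beta_2$, (d) $X^\dagger\circ X=0$, and (e) $X^\dagger\circ\alpha_2=0$. Then the following statements hold. (M.F. 1) Let $G_{\mathrm{even}}=M_{1,2}\oplus K_2\oplus M_3\oplus K_4$ and $G_{\mathrm{odd}}=M_2\oplus K_3\oplus M_4$, and let $g_{\mathrm{even}}:G_{\mathrm{even}}\to G_{\mathrm{odd}}$ and $g_{\mathrm{odd}}:G_{\mathrm{odd}}\to G_{\mathrm{even}}$ be the $P$-module homomorphisms $$g_{\mathrm{even}}=\begin{bmatrix} (rX-w_1)|_{M_{1,2}} & \alpha_2 & m_3 & 0 \\ 0 & -z_2 & r\beta_3 & -k_4 \\ 0 & 0 & -w_3 & \alpha_4 \end{bmatrix},\qquad g_{\mathrm{odd}}=\begin{bmatrix} \mathrm{proj}_{M_{1,2}}\circ m_2 & 0 & 0 \\ r\beta_2-Y & -k_3 & 0 \\ rX^\dagger+w_2 & \alpha_3 & m_4 \\ 0 & z_3 & r\beta_4 \end{bmatrix}.$$ Then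 $g_{\mathrm{odd}}\circ g_{\mathrm{even}}=f\cdot\mathrm{id}_{G_{\mathrm{even}}}$ and $g_{\mathrm{even}}\circ g_{\mathrm{odd}}=f\cdot\mathrm{id}_{G_{\mathrm{odd}}}$. (M.F. 2) Assume that $r$ is a unit. Let $\acute G_{\mathrm{even}}=M_{1,2}\oplus K_2\oplus M_{3,2}$ and $\acute G_{\mathrm{odd}}=M_2$, and let $\acute g_{\mathrm{even}}:\acute G_{\mathrm{even}}\to\acute G_{\mathrm{odd}}$ and $\acute g_{\mathrm{odd}}:\acute G_{\mathrm{odd}}\to\acute G_{\mathrm{even}}$ be the $P$-module homomorphisms $$\acute g_{\mathrm{even}}=\begin{bmatrix} (rX-w_1)|_{M_{1,2}} & \alpha_2+r^{-1}W & m_3|_{M_{3,2}} \end{bmatrix},\qquad \acute g_{\mathrm{odd}}=\begin{bmatrix} \mathrm{proj}_{M_{1,2}}\circ m_2 \\ r\beta_2-Y \\ \mathrm{proj}_{M_{3,2}}\circ(rX^\dagger+w_2) \end{bmatrix}.$$ Then $\acute g_{\mathrm{odd}}\circ\acute g_{\mathrm{even}}=f\cdot\mathrm{id}_{\acute G_{\mathrm{even}}}$ and $\acute g_{\mathrm{even}}\circ\acute g_{\mathrm{odd}}=f\cdot\mathrm{id}_{\acute G_{\mathrm{odd}}}$.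
   Context: **DG$\Gamma$-algebras.** A DG-algebra $F$ over a commutative Noetherian ring $P$ is a complex of finitely generated free $P$-modules $\cdots\to F_1\xrightarrow{d_1}F_0=P$ with a unitary associative multiplication satisfying $F_iF_j\subseteq F_{i+j}$, $d(x_ix_j)=d(x_i)x_j+(-1)^ix_id(x_j)$, $x_ix_j=(-1)^{ij}x_jx_i$, and $x_i^2=0$ for $i$ odd ($x_\ell\in F_\ell$). It is a DG$\Gamma$-algebra if each $x_i\in F_i$ with $i$ positive and even has divided powers $x_i^{(k)}\in F_{ik}$ satisfying the usual divided power axioms and $d(x_i^{(k)})=d(x_i)x_i^{(k-1)}$. It exhibits Poincaré duality if for some $m$ one has $F_i=0$ for $i>m$, $F_m\cong P$, and each multiplication map $F_i\otimes_PF_{m-i}\to F_m$ is a perfect pairing. **Data.** $P$ is a commutative Noetherian ring, $f$ is a regular element (non-zero-divisor) of $P$, $\mathfrak K$ is an ideal of $P$ generated by a regular sequence of length four, and $$M:\ 0\to M_4\xrightarrow{m_4}M_3\xrightarrow{m_3}M_2\xrightarrow{m_2}M_1\xrightarrow{m_1}M_0=P$$ is a resolution of $P/(\mathfrak K:f)$ by free $P$-modules such that $M$ is a DG$\Gamma$-algebra which exhibits Poincaré duality, and $M_1=M_{1,1}\oplus M_{1,2}$ is a direct sum of two free submodules with $\mathrm{rank}\,M_{1,1}=4$ and $m_1(M_{1,1})=\mathfrak K$. **The maps $\alpha$ and $\beta$.** $K:\ 0\to K_4\xrightarrow{k_4}K_3\xrightarrow{k_3}K_2\xrightarrow{k_2}K_1\xrightarrow{k_1}K_0=P$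 is the Koszul complex which is a resolution of $P/\mathfrak K$ (a DG$\Gamma$-algebra with Poincaré duality; its product is written $\wedge$). Fix orientation isomorphisms $[-]_K:K_4\to P$ and $[-]_M:M_4\to P$. Let $\alpha_0:K_0=P\to M_0=P$ be the identity, and let $\alpha_1:K_1\to M_1$ be such that $\mathrm{proj}_{M_{1,1}}\circ\alpha_1:K_1\to M_{1,1}$ is the (fixed) isomorphism with $m_1|_{M_{1,1}}\circ\mathrm{proj}_{M_{1,1}}\circ\alpha_1=k_1$, and $\mathrm{proj}_{M_{1,2}}\circ\alpha_1=0$. Let $\alpha:K\to M$ be the map of DG$\Gamma$-algebras which extends $\alpha_0$ and $\alpha_1$. Define $\beta_i:M_i\to K_i$ by $[\beta_i(\theta_i)\wedge\phi_{4-i}]_K=[\theta_i\cdot\alpha_{4-i}(\phi_{4-i})]_M$ for all $\theta_i\in M_i$, $\phi_{4-i}\in K_{4-i}$. In particular $\beta_0(1)\in K_0=P$. **The adjoint.** For a homomorphism $h:M_1\to M_2$, $h^\dagger:M_2\to M_3$ is defined by $h^\dagger(\theta_2)\cdot\theta_1=\theta_2\cdot h(\theta_1)$ in $M_4$ for all $\theta_i\in M_i$. **Further data.** $r\in P$ and $\sigma\in K_1$ are fixed elements with $f=r\beta_0(1)+k_1(\sigma)$ (such elements exist by linkage theory). Put $M_{3,1}=\{\theta_3\in M_3\mid\theta_3M_{1,2}=0\}$ and $M_{3,2}=\{\theta_3\in M_3\mid\theta_3M_{1,1}=0\}$; then $M_3=M_{3,1}\oplus M_{3,2}$. The map $\beta_3|_{M_{3,1}}:M_{3,1}\to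 K_3$ is an isomorphism. Define $z_i:K_i\to K_{i+1}$ by $z_i(\phi_i)=\phi_i\wedge\sigma$ and $w_i:M_i\to M_{i+1}$ by $w_i(\theta_i)=\theta_i\cdot\alpha_1(\sigma)$. Define $Y:M_2\to K_2$ by $Y=z_1\circ(\mathrm{proj}_{M_{1,1}}\circ\alpha_1)^{-1}\circ\mathrm{proj}_{M_{1,1}}\circ m_2$ and $W:K_2\to M_2$ by $W=m_3\circ(\beta_3|_{M_{3,1}})^{-1}\circ z_2$. All projections are with respect to the stated direct sum decompositions of $M_1$ and $M_3$. *)

theory Defs
  imports "HOL-Analysis.Product_Vector"
begin

section \<open>Commutative algebra over a type-class ring\<close>

text \<open>
  Ideals of a ring \<open>'p :: comm_ring_1\<close> are the sets \<open>I\<close> with \<open>module.subspace (*) I\<close>, and the ideal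
  generated by a set is its \<open>module.span (*)\<close>.  All other modules are submodules of (the carrier
  of) some ambient module, given by a scalar multiplication satisfying the locale \<open>module\<close>; maps
  between them are only constrained on those submodules.
\<close>

definition noetherian :: "'p::comm_ring_1 itself \<Rightarrow> bool" where
  "noetherian _ \<longleftrightarrow>
     (\<forall>I :: 'p set. module.subspace (*) I \<longrightarrow> (\<exists>S. finite S \<and> I = module.span (*) S))"

definition regular_element :: "'p::comm_ring_1 \<Rightarrow> bool" where
  "regular_element f \<longleftrightarrow> (\<forall>p. f * p = 0 \<longrightarrow> p = 0)"

definition regular_sequence :: "'p::comm_ring_1 list \<Rightarrow> bool" where
  "regular_sequence as \<longleftrightarrow>
     (\<forall>i<length as. \<forall>p. as ! i * p \<in> module.span (*) (set (take i as)) \<longrightarrow>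
                        p \<in> module.span (*) (set (take i as))) \<and>
     module.span (*) (set as) \<noteq> UNIV"

definition colon :: "'p::comm_ring_1 set \<Rightarrow> 'p \<Rightarrow> 'p set" where
  "colon I f = {p. p * f \<in> I}"

definition free_of_rank ::
  "('p::comm_ring_1 \<Rightarrow> 'm::ab_group_add \<Rightarrow> 'm) \<Rightarrow> 'm set \<Rightarrow> nat \<Rightarrow> bool" where
  "free_of_rank s A n \<longleftrightarrow>
     (\<exists>B. finite B \<and> card B = n \<and> \<not> module.dependent s B \<and> module.span s B = A)"

definition lin_map ::
  "('p::comm_ring_1 \<Rightarrow> 'a::ab_group_add \<Rightarrow> 'a) \<Rightarrow> 'a set \<Rightarrow>
   ('p \<Rightarrow> 'b::ab_group_add \<Rightarrow> 'b) \<Rightarrow> 'b set \<Rightarrow> ('a \<Rightarrow> 'b) \<Rightarrow> bool" where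
  "lin_map s A t B h \<longleftrightarrow>
     (\<forall>x\<in>A. h x \<in> B) \<and>
     (\<forall>x\<in>A. \<forall>y\<in>A. h (x + y) = h x + h y) \<and>
     (\<forall>c. \<forall>x\<in>A. h (s c x) = t c (h x))"

definition lin_iso ::
  "('p::comm_ring_1 \<Rightarrow> 'a::ab_group_add \<Rightarrow> 'a) \<Rightarrow> 'a set \<Rightarrow>
   ('p \<Rightarrow> 'b::ab_group_add \<Rightarrow> 'b) \<Rightarrow> 'b set \<Rightarrow> ('a \<Rightarrow> 'b) \<Rightarrow> bool" where
  "lin_iso s A t B h \<longleftrightarrow> lin_map s A t B h \<and> bij_betw h A B"

definition direct_sum ::
  "('p::comm_ring_1 \<Rightarrow> 'm::ab_group_add \<Rightarrow> 'm) \<Rightarrow> 'm set \<Rightarrow> 'm set \<Rightarrow> 'm set \<Rightarrow> bool" where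
  "direct_sum s A B C \<longleftrightarrow>
     module.subspace s B \<and> module.subspace s C \<and> A = {b + c | b c. b \<in> B \<and> c \<in> C} \<and> B \<inter> C = {0}"

text \<open>Projection of \<open>B \<oplus> C\<close> onto \<open>B\<close>.\<close>

definition proj :: "'m::ab_group_add set \<Rightarrow> 'm set \<Rightarrow> 'm \<Rightarrow> 'm" where
  "proj B C x = (THE b. b \<in> B \<and> (\<exists>c\<in>C. x = b + c))"


section \<open>DG-algebras and divided powers\<close>

text \<open>
  The homogeneous components \<open>gr F i\<close> are submodules of one ambient module, which need not be their
  direct sum (they may even overlap), so the operations carry the degrees of their arguments:
  \<open>bd F i\<close> is the differential on \<open>gr F i\<close>, \<open>mul F i j\<close> the product of \<open>gr F i\<close> and \<open>gr F j\<close>, and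
  \<open>dpow F i k x\<close> the divided power of order \<open>k\<close> of \<open>x\<close> in \<open>gr F i\<close>.
\<close>

record ('p, 'm) dg =
  smul :: "'p \<Rightarrow> 'm \<Rightarrow> 'm"
  gr :: "nat \<Rightarrow> 'm set"
  bd :: "nat \<Rightarrow> 'm \<Rightarrow> 'm"
  mul :: "nat \<Rightarrow> nat \<Rightarrow> 'm \<Rightarrow> 'm \<Rightarrow> 'm"
  un :: 'm

record ('p, 'm) dgg = "('p, 'm) dg" +
  dpow :: "nat \<Rightarrow> nat \<Rightarrow> 'm \<Rightarrow> 'm"

text \<open>
  \<open>F\<^sub>0 = P\<close> is rendered by \<open>deg0\<close>: the element \<open>p\<close> of the ring is identified with \<open>p \<sdot> 1\<close>.  By \<open>bd_0\<close>,
  in the Leibniz rule the terms with an out-of-range degree \<open>0 - 1\<close> are products with \<open>0\<close>.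
\<close>

locale dg_algebra = module "smul F"
  for F :: "('p::comm_ring_1, 'm::ab_group_add, 'z) dg_scheme" +
  assumes free: "\<exists>n. free_of_rank (smul F) (gr F i) n"
    and deg0: "bij_betw (\<lambda>p. smul F p (un F)) UNIV (gr F 0)"
    and bd_hom: "lin_map (smul F) (gr F (Suc i)) (smul F) (gr F i) (bd F (Suc i))"
    and bd_0: "x \<in> gr F 0 \<Longrightarrow> bd F 0 x = 0"
    and bd_bd: "x \<in> gr F (Suc (Suc i)) \<Longrightarrow> bd F (Suc i) (bd F (Suc (Suc i)) x) = 0"
    and mul_hom_left: "y \<in> gr F j \<Longrightarrow>
          lin_map (smul F) (gr F i) (smul F) (gr F (i + j)) (\<lambda>x. mul F i j x y)"
    and mul_hom_right: "x \<in> gr F i \<Longrightarrow>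
          lin_map (smul F) (gr F j) (smul F) (gr F (i + j)) (\<lambda>y. mul F i j x y)"
    and mul_assoc: "\<lbrakk>x \<in> gr F i; y \<in> gr F j; z \<in> gr F k\<rbrakk> \<Longrightarrow>
          mul F (i + j) k (mul F i j x y) z = mul F i (j + k) x (mul F j k y z)"
    and mul_un_left: "x \<in> gr F i \<Longrightarrow> mul F 0 i (un F) x = x"
    and mul_un_right: "x \<in> gr F i \<Longrightarrow> mul F i 0 x (un F) = x"
    and leibniz: "\<lbrakk>x \<in> gr F i; y \<in> gr F j\<rbrakk> \<Longrightarrow>
          bd F (i + j) (mul F i j x y) =
            mul F (i - 1) j (bd F i x) y + smul F ((-1) ^ i) (mul F i (j - 1) x (bd F j y))"
    and graded_comm: "\<lbrakk>x \<in> gr F i; y \<in> gr F j\<rbrakk> \<Longrightarrow>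
          mul F i j x y = smul F ((-1) ^ (i * j)) (mul F j i y x)"
    and odd_square: "\<lbrakk>x \<in> gr F i; odd i\<rbrakk> \<Longrightarrow> mul F i i x x = 0"

text \<open>The element of the ring that corresponds to an element of \<open>F\<^sub>0 = P\<close>.\<close>

definition scalar :: "('p, 'm, 'z) dg_scheme \<Rightarrow> 'm \<Rightarrow> 'p" where
  "scalar F x = (THE p. x = smul F p (un F))"

text \<open>The ordinary power of an element of degree \<open>i\<close>.\<close>

fun mpow :: "('p, 'm, 'z) dg_scheme \<Rightarrow> nat \<Rightarrow> nat \<Rightarrow> 'm \<Rightarrow> 'm" where
  "mpow F i 0 x = un F"
| "mpow F i (Suc k) x = mul F (i * k) i (mpow F i k x) x"

text \<open>The divided power axioms are those of Gulliksen and Levin.\<close>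

locale dg_gamma_algebra = dg_algebra F
  for F :: "('p::comm_ring_1, 'm::ab_group_add, 'z) dgg_scheme" +
  assumes dpow_in: "\<lbrakk>x \<in> gr F i; even i; 0 < i\<rbrakk> \<Longrightarrow> dpow F i k x \<in> gr F (i * k)"
    and dpow_0: "\<lbrakk>x \<in> gr F i; even i; 0 < i\<rbrakk> \<Longrightarrow> dpow F i 0 x = un F"
    and dpow_1: "\<lbrakk>x \<in> gr F i; even i; 0 < i\<rbrakk> \<Longrightarrow> dpow F i 1 x = x"
    and dpow_mul: "\<lbrakk>x \<in> gr F i; even i; 0 < i\<rbrakk> \<Longrightarrow>
          mul F (i * k) (i * l) (dpow F i k x) (dpow F i l x) =
            smul F (of_nat ((k + l) choose k)) (dpow F i (k + l) x)"
    and dpow_add: "\<lbrakk>x \<in> gr F i; y \<in> gr F i; even i; 0 < i\<rbrakk> \<Longrightarrow>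
          dpow F i k (x + y) =
            (\<Sum>j\<le>k. mul F (i * j) (i * (k - j)) (dpow F i j x) (dpow F i (k - j) y))"
    and dpow_even_mul: "\<lbrakk>x \<in> gr F i; y \<in> gr F j; even i; even j; 0 < j\<rbrakk> \<Longrightarrow>
          dpow F (i + j) k (mul F i j x y) = mul F (i * k) (j * k) (mpow F i k x) (dpow F j k y)"
    and dpow_odd_mul: "\<lbrakk>x \<in> gr F i; y \<in> gr F j; odd i; odd j; 2 \<le> k\<rbrakk> \<Longrightarrow>
          dpow F (i + j) k (mul F i j x y) = 0"
    and dpow_dpow: "\<lbrakk>x \<in> gr F i; even i; 0 < i; 0 < k\<rbrakk> \<Longrightarrow>
          dpow F (i * k) l (dpow F i k x) =
            smul F (of_nat (fact (k * l) div (fact l * fact k ^ l))) (dpow F i (k * l) x)"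
    and bd_dpow: "\<lbrakk>x \<in> gr F i; even i; 0 < i; 0 < k\<rbrakk> \<Longrightarrow>
          bd F (i * k) (dpow F i k x) = mul F (i - 1) (i * (k - 1)) (bd F i x) (dpow F i (k - 1) x)"

definition dgg_hom ::
  "('p::comm_ring_1, 'k::ab_group_add, 'y) dgg_scheme \<Rightarrow>
   ('p, 'm::ab_group_add, 'z) dgg_scheme \<Rightarrow> (nat \<Rightarrow> 'k \<Rightarrow> 'm) \<Rightarrow> bool" where
  "dgg_hom K M \<alpha> \<longleftrightarrow>
     (\<forall>i. lin_map (smul K) (gr K i) (smul M) (gr M i) (\<alpha> i)) \<and>
     (\<forall>i. \<forall>x\<in>gr K (Suc i). bd M (Suc i) (\<alpha> (Suc i) x) = \<alpha> i (bd K (Suc i) x)) \<and>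
     \<alpha> 0 (un K) = un M \<and>
     (\<forall>i j. \<forall>x\<in>gr K i. \<forall>y\<in>gr K j. \<alpha> (i + j) (mul K i j x y) = mul M i j (\<alpha> i x) (\<alpha> j y)) \<and>
     (\<forall>i k. even i \<and> 0 < i \<longrightarrow> (\<forall>x\<in>gr K i. \<alpha> (i * k) (dpow K i k x) = dpow M i k (\<alpha> i x)))"

text \<open>
  A pairing \<open>A \<times> B \<rightarrow> C\<close> is perfect if it induces isomorphisms \<open>A \<rightarrow> Hom(B, C)\<close> and \<open>B \<rightarrow> Hom(A, C)\<close>.
\<close>

definition perfect_pairing ::
  "('p::comm_ring_1 \<Rightarrow> 'm::ab_group_add \<Rightarrow> 'm) \<Rightarrow> 'm set \<Rightarrow> 'm set \<Rightarrow> 'm set \<Rightarrow>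
   ('m \<Rightarrow> 'm \<Rightarrow> 'm) \<Rightarrow> bool" where
  "perfect_pairing s A B C \<mu> \<longleftrightarrow>
     (\<forall>h. lin_map s B s C h \<longrightarrow> (\<exists>!x. x \<in> A \<and> (\<forall>y\<in>B. \<mu> x y = h y))) \<and>
     (\<forall>h. lin_map s A s C h \<longrightarrow> (\<exists>!y. y \<in> B \<and> (\<forall>x\<in>A. \<mu> x y = h x)))"

definition poincare_duality ::
  "('p::comm_ring_1, 'm::ab_group_add, 'z) dg_scheme \<Rightarrow> nat \<Rightarrow> bool" where
  "poincare_duality F m \<longleftrightarrow>
     (\<forall>i>m. gr F i = {0}) \<and>
     (\<exists>h. lin_iso (smul F) (gr F m) (*) UNIV h) \<and>
     (\<forall>i\<le>m. perfect_pairing (smul F) (gr F i) (gr F (m - i)) (gr F m) (mul F i (m - i)))"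

text \<open>\<open>F\<close> is a resolution of \<open>P/I\<close>, augmented by the quotient map from \<open>F\<^sub>0 = P\<close>.\<close>

definition resolution_of ::
  "('p::comm_ring_1, 'm::ab_group_add, 'z) dg_scheme \<Rightarrow> 'p set \<Rightarrow> bool" where
  "resolution_of F I \<longleftrightarrow>
     (\<lambda>x. scalar F (bd F 1 x)) ` gr F 1 = I \<and>
     (\<forall>i\<ge>1. {x \<in> gr F i. bd F i x = 0} = bd F (Suc i) ` gr F (Suc i))"

text \<open>
  A DG-algebra is a Koszul complex on \<open>n\<close> elements if its underlying graded algebra is the exterior
  algebra of a free module \<open>F\<^sub>1\<close> of rank \<open>n\<close>: for a basis \<open>e\<close> of \<open>F\<^sub>1\<close>, the products
  \<open>e i\<^sub>1 \<and> \<dots> \<and> e i\<^sub>k\<close> with \<open>i\<^sub>1 < \<dots> < i\<^sub>k\<close> form a basis of \<open>F\<^sub>k\<close>.  By the Leibniz rule its differential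
  is then the Koszul differential of the linear form \<open>bd F 1\<close>.
\<close>

fun wedge_list :: "('p, 'm, 'z) dg_scheme \<Rightarrow> (nat \<Rightarrow> 'm) \<Rightarrow> nat list \<Rightarrow> 'm" where
  "wedge_list F e [] = un F"
| "wedge_list F e (i # is) = mul F 1 (length is) (e i) (wedge_list F e is)"

definition koszul_complex ::
  "('p::comm_ring_1, 'm::ab_group_add, 'z) dg_scheme \<Rightarrow> nat \<Rightarrow> bool" where
  "koszul_complex F n \<longleftrightarrow> dg_algebra F \<and>
     (\<exists>e. (\<forall>j<n. e j \<in> gr F 1) \<and>
       (\<forall>i. let \<S> = {S. S \<subseteq> {..<n} \<and> card S = i};
                 w = (\<lambda>S. wedge_list F e (sorted_list_of_set S))
             in inj_on w \<S> \<and> \<not> module.dependent (smul F) (w ` \<S>) \<and>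
                module.span (smul F) (w ` \<S>) = gr F i))"


section \<open>Dual maps in length four\<close>

text \<open>
  Here \<open>oK\<close> and \<open>oM\<close> are the orientation isomorphisms of \<open>K\<^sub>4\<close> and \<open>M\<^sub>4\<close> with the ring, and the
  result is \<open>\<beta>\<^sub>i\<close>, for \<open>i \<le> 4\<close>.
\<close>

definition dual_map ::
  "('p, 'k, 'y) dg_scheme \<Rightarrow> ('p, 'm, 'z) dg_scheme \<Rightarrow> ('k \<Rightarrow> 'p) \<Rightarrow> ('m \<Rightarrow> 'p) \<Rightarrow>
   (nat \<Rightarrow> 'k \<Rightarrow> 'm) \<Rightarrow> nat \<Rightarrow> 'm \<Rightarrow> 'k" where
  "dual_map K M oK oM \<alpha> i \<theta> =
     (THE \<psi>. \<psi> \<in> gr K i \<and>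
        (\<forall>\<phi>\<in>gr K (4 - i). oK (mul K i (4 - i) \<psi> \<phi>) = oM (mul M i (4 - i) \<theta> (\<alpha> (4 - i) \<phi>))))"

text \<open>For \<open>h : M\<^sub>1 \<rightarrow> M\<^sub>2\<close>, the map \<open>h\<^sup>\<dagger> : M\<^sub>2 \<rightarrow> M\<^sub>3\<close>.\<close>

definition adjoint_map :: "('p, 'm, 'z) dg_scheme \<Rightarrow> ('m \<Rightarrow> 'm) \<Rightarrow> 'm \<Rightarrow> 'm" where
  "adjoint_map M h \<theta>2 =
     (THE \<theta>3. \<theta>3 \<in> gr M 3 \<and> (\<forall>\<theta>1\<in>gr M 1. mul M 3 1 \<theta>3 \<theta>1 = mul M 2 2 \<theta>2 (h \<theta>1)))"


section \<open>The two pairs of maps\<close>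

text \<open>Right multiplication by \<open>\<tau> \<in> F\<^sub>1\<close>: \<open>w\<^sub>i\<close> for \<open>\<tau> = \<alpha>\<^sub>1 \<sigma>\<close> in \<open>M\<close>, and \<open>z\<^sub>i\<close> for \<open>\<tau> = \<sigma>\<close> in \<open>K\<close>.\<close>

definition rmul :: "('p, 'm, 'z) dg_scheme \<Rightarrow> 'm \<Rightarrow> nat \<Rightarrow> 'm \<Rightarrow> 'm" where
  "rmul F \<tau> i \<theta> = mul F i 1 \<theta> \<tau>"

text \<open>
  \<open>M\<^sub>3\<^sub>,\<^sub>1\<close> is the annihilator of \<open>M\<^sub>1\<^sub>,\<^sub>2\<close> in \<open>M\<^sub>3\<close>, and \<open>M\<^sub>3\<^sub>,\<^sub>2\<close> is that of \<open>M\<^sub>1\<^sub>,\<^sub>1\<close>.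
\<close>

definition ann3 :: "('p, 'm::zero, 'z) dg_scheme \<Rightarrow> 'm set \<Rightarrow> 'm set" where
  "ann3 M N = {\<theta> \<in> gr M 3. \<forall>x\<in>N. mul M 3 1 \<theta> x = 0}"

definition Y_map ::
  "('p, 'k, 'y) dg_scheme \<Rightarrow> ('p, 'm::ab_group_add, 'z) dg_scheme \<Rightarrow> 'm set \<Rightarrow> 'm set \<Rightarrow>
   (nat \<Rightarrow> 'k \<Rightarrow> 'm) \<Rightarrow> 'k \<Rightarrow> 'm \<Rightarrow> 'k" where
  "Y_map K M M11 M12 \<alpha> \<sigma> =
     rmul K \<sigma> 1 \<circ> inv_into (gr K 1) (proj M11 M12 \<circ> \<alpha> 1) \<circ> proj M11 M12 \<circ> bd M 2"

definition W_map ::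
  "('p, 'k, 'y) dg_scheme \<Rightarrow> ('p, 'm::ab_group_add, 'z) dg_scheme \<Rightarrow> 'm set \<Rightarrow>
   (nat \<Rightarrow> 'm \<Rightarrow> 'k) \<Rightarrow> 'k \<Rightarrow> 'k \<Rightarrow> 'm" where
  "W_map K M M12 \<beta> \<sigma> = bd M 3 \<circ> inv_into (ann3 M M12) (\<beta> 3) \<circ> rmul K \<sigma> 2"

text \<open>
  In the following four maps the matrices act on columns, written as tuples; \<open>s\<close> stands for \<open>r\<^sup>-\<^sup>1\<close>.
\<close>

definition g_even ::
  "('p, 'k::ab_group_add, 'y) dg_scheme \<Rightarrow> ('p, 'm::ab_group_add, 'z) dg_scheme \<Rightarrow>
   (nat \<Rightarrow> 'k \<Rightarrow> 'm) \<Rightarrow> (nat \<Rightarrow> 'm \<Rightarrow> 'k) \<Rightarrow> 'p \<Rightarrow> 'k \<Rightarrow> ('m \<Rightarrow> 'm) \<Rightarrow>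
   'm \<times> 'k \<times> 'm \<times> 'k \<Rightarrow> 'm \<times> 'k \<times> 'm" where
  "g_even K M \<alpha> \<beta> r \<sigma> X = (\<lambda>(\<theta>1, \<phi>2, \<theta>3, \<phi>4).
     (smul M r (X \<theta>1) - rmul M (\<alpha> 1 \<sigma>) 1 \<theta>1 + \<alpha> 2 \<phi>2 + bd M 3 \<theta>3,
      - rmul K \<sigma> 2 \<phi>2 + smul K r (\<beta> 3 \<theta>3) - bd K 4 \<phi>4,
      - rmul M (\<alpha> 1 \<sigma>) 3 \<theta>3 + \<alpha> 4 \<phi>4))"

definition g_odd ::
  "('p, 'k::ab_group_add, 'y) dg_scheme \<Rightarrow> ('p, 'm::ab_group_add, 'z) dg_scheme \<Rightarrow>
   'm set \<Rightarrow> 'm set \<Rightarrow> (nat \<Rightarrow> 'k \<Rightarrow> 'm) \<Rightarrow> (nat \<Rightarrow> 'm \<Rightarrow> 'k) \<Rightarrow> 'p \<Rightarrow> 'k \<Rightarrow> ('m \<Rightarrow> 'm) \<Rightarrow>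
   'm \<times> 'k \<times> 'm \<Rightarrow> 'm \<times> 'k \<times> 'm \<times> 'k" where
  "g_odd K M M11 M12 \<alpha> \<beta> r \<sigma> X = (\<lambda>(\<theta>2, \<phi>3, \<theta>4).
     (proj M12 M11 (bd M 2 \<theta>2),
      smul K r (\<beta> 2 \<theta>2) - Y_map K M M11 M12 \<alpha> \<sigma> \<theta>2 - bd K 3 \<phi>3,
      smul M r (adjoint_map M X \<theta>2) + rmul M (\<alpha> 1 \<sigma>) 2 \<theta>2 + \<alpha> 3 \<phi>3 + bd M 4 \<theta>4,
      rmul K \<sigma> 3 \<phi>3 + smul K r (\<beta> 4 \<theta>4)))"

definition g_even' ::
  "('p, 'k::ab_group_add, 'y) dg_scheme \<Rightarrow> ('p, 'm::ab_group_add, 'z) dg_scheme \<Rightarrow>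
   'm set \<Rightarrow> (nat \<Rightarrow> 'k \<Rightarrow> 'm) \<Rightarrow> (nat \<Rightarrow> 'm \<Rightarrow> 'k) \<Rightarrow> 'p \<Rightarrow> 'p \<Rightarrow> 'k \<Rightarrow> ('m \<Rightarrow> 'm) \<Rightarrow>
   'm \<times> 'k \<times> 'm \<Rightarrow> 'm" where
  "g_even' K M M12 \<alpha> \<beta> r s \<sigma> X = (\<lambda>(\<theta>1, \<phi>2, \<theta>3).
     smul M r (X \<theta>1) - rmul M (\<alpha> 1 \<sigma>) 1 \<theta>1
     + (\<alpha> 2 \<phi>2 + smul M s (W_map K M M12 \<beta> \<sigma> \<phi>2))
     + bd M 3 \<theta>3)"

definition g_odd' ::
  "('p, 'k::ab_group_add, 'y) dg_scheme \<Rightarrow> ('p, 'm::ab_group_add, 'z) dg_scheme \<Rightarrow>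
   'm set \<Rightarrow> 'm set \<Rightarrow> (nat \<Rightarrow> 'k \<Rightarrow> 'm) \<Rightarrow> (nat \<Rightarrow> 'm \<Rightarrow> 'k) \<Rightarrow> 'p \<Rightarrow> 'k \<Rightarrow> ('m \<Rightarrow> 'm) \<Rightarrow>
   'm \<Rightarrow> 'm \<times> 'k \<times> 'm" where
  "g_odd' K M M11 M12 \<alpha> \<beta> r \<sigma> X = (\<lambda>\<theta>2.
     (proj M12 M11 (bd M 2 \<theta>2),
      smul K r (\<beta> 2 \<theta>2) - Y_map K M M11 M12 \<alpha> \<sigma> \<theta>2,
      proj (ann3 M M11) (ann3 M M12)
        (smul M r (adjoint_map M X \<theta>2) + rmul M (\<alpha> 1 \<sigma>) 2 \<theta>2)))"

definition matrix_factorization ::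
  "'p::comm_ring_1 \<Rightarrow> ('p \<Rightarrow> 'a::ab_group_add \<Rightarrow> 'a) \<Rightarrow> 'a set \<Rightarrow>
   ('p \<Rightarrow> 'b::ab_group_add \<Rightarrow> 'b) \<Rightarrow> 'b set \<Rightarrow> ('a \<Rightarrow> 'b) \<Rightarrow> ('b \<Rightarrow> 'a) \<Rightarrow> bool" where
  "matrix_factorization f s A t B g h \<longleftrightarrow>
     lin_map s A t B g \<and> lin_map t B s A h \<and>
     (\<forall>x\<in>A. h (g x) = s f x) \<and> (\<forall>y\<in>B. g (h y) = t f y)"

end

theory Submission
  imports Defs
begin

text \<open>
  Write \<open>b\<close> for the scalar \<open>\<beta>\<^sub>0(1)\<close>, \<open>a = \<alpha>\<^sub>1(\<sigma>)\<close> and \<open>k = k\<^sub>1(\<sigma>)\<close>, so that \<open>f = r b + k\<close>.  Two homotopies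
  produce the two summands.  Multiplication by \<open>\<sigma>\<close> on \<open>K\<close> and by \<open>a\<close> on \<open>M\<close> (the maps \<open>z\<close> and \<open>w\<close>)
  contracts \<open>k\<close>, by the Leibniz rule; the pair \<open>X\<close>, \<open>X\<^sup>\<dagger>\<close> contracts \<open>b - \<alpha> \<circ> \<beta>\<close> on \<open>M\<close>, while
  \<open>\<beta> \<circ> \<alpha> = b\<close> on \<open>K\<close>.  The matrices combine \<open>r\<close> times the second homotopy with the first one and
  with the maps \<open>\<alpha>\<close> and \<open>\<beta>\<close>.  Multiplying them out, every entry of the products cancels or adds up
  to \<open>f\<close>, given the following relations.

  \<^item> The map \<open>\<beta>\<close>, being the transpose of \<open>\<alpha>\<close> under Poincare duality, is a chain map and is linear over
    \<open>K\<close>; this gives \<open>\<beta> \<circ> \<alpha> = b\<close>, also \<open>\<alpha>\<^sub>4 \<circ> \<beta>\<^sub>4 = b\<close>, and the compatibility of \<open>\<beta>\<close> with \<open>w\<close> and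
    \<open>z\<close> (lemmas \<open>beta_bd\<close>, \<open>beta_mul\<close>, \<open>beta_alpha\<close>, \<open>alpha_beta4\<close>).

  \<^item> Transposing the hypotheses gives \<open>X\<^sup>\<dagger> \<circ> m\<^sub>3 = b - \<alpha>\<^sub>3 \<circ> \<beta>\<^sub>3\<close>, \<open>\<beta>\<^sub>2 \<circ> X = 0\<close> and
    \<open>\<beta>\<^sub>3 \<circ> X\<^sup>\<dagger> = 0\<close> (lemmas \<open>adj_bd\<close>, \<open>beta_X\<close>, \<open>beta_adj\<close>).

  \<^item> The homotopies commute: \<open>X\<^sup>\<dagger> \<circ> w\<^sub>1 = w\<^sub>2 \<circ> X\<close> (lemma \<open>adj_w1\<close>).  This is where the exactness of \<open>M\<close>
    and the presence of a regular element in the ideal \<open>\<KK>\<close> are used.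

  The use of \<open>\<beta>\<close> presupposes that \<open>K\<close> has Poincare duality, which is
  \<open>koszul_complex_poincare_duality\<close>: in the exterior algebra on \<open>n\<close> generators the basis products of
  complementary degrees are dual to each other up to sign.

  For a unit \<open>r\<close>, the second factorization is carried by the first.  The large even map takes the
  elements \<open>(\<theta>\<^sub>1, \<phi>\<^sub>2, \<theta>\<^sub>3 + r\<^sup>-\<^sup>1 \<rho>(z\<^sub>2 \<phi>\<^sub>2), 0)\<close>, where \<open>\<theta>\<^sub>3\<close> is in \<open>M\<^sub>3\<^sub>,\<^sub>2\<close> and \<open>\<rho>\<close> is the inverse of
  \<open>\<beta>\<^sub>3\<close> on \<open>M\<^sub>3\<^sub>,\<^sub>1\<close>, to the value of the small even map in the summand \<open>M\<^sub>2\<close> (lemma \<open>g_even_reduce\<close>),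
  and the large odd map takes that summand back to such elements.  So both products of the small pair
  are read off from those of the large pair.
\<close>

section \<open>Maps that are linear on submodules\<close>

lemma lin_map_in: "lin_map s A t B h \<Longrightarrow> x \<in> A \<Longrightarrow> h x \<in> B"
  and lin_map_add: "lin_map s A t B h \<Longrightarrow> x \<in> A \<Longrightarrow> y \<in> A \<Longrightarrow> h (x + y) = h x + h y"
  and lin_map_scale: "lin_map s A t B h \<Longrightarrow> x \<in> A \<Longrightarrow> h (s c x) = t c (h x)"
  by (simp_all add: lin_map_def)

lemma lin_mapI:
  assumes "\<And>x. x \<in> A \<Longrightarrow> h x \<in> B"
    and "\<And>x y. x \<in> A \<Longrightarrow> y \<in> A \<Longrightarrow> h (x + y) = h x + h y"
    and "\<And>c x. x \<in> A \<Longrightarrow> h (s c x) = t c (h x)"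
  shows "lin_map s A t B h"
  using assms by (simp add: lin_map_def)

lemma module_mult: "module ((*) :: 'p::comm_ring_1 \<Rightarrow> 'p \<Rightarrow> 'p)"
  by unfold_locales (simp_all add: algebra_simps)

context module_pair
begin

lemma lin_map_zero:
  assumes "lin_map s1 A s2 B h" and "m1.subspace A"
  shows "h 0 = 0"
  using lin_map_scale[OF assms(1) m1.subspace_0[OF assms(2)], of 0] by simp

lemma lin_map_neg:
  assumes "lin_map s1 A s2 B h" and "x \<in> A"
  shows "h (- x) = - h x"
  using lin_map_scale[OF assms, of "-1"] by simp

lemma lin_map_diff:
  assumes "lin_map s1 A s2 B h" and "m1.subspace A" and "x \<in> A" and "y \<in> A"
  shows "h (x - y) = h x - h y"
  using lin_map_add[OF assms(1,3) m1.subspace_neg[OF assms(2,4)]] lin_map_neg[OF assms(1,4)]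
  by simp

lemma lin_map_sum:
  assumes "lin_map s1 A s2 B h" and "m1.subspace A" and "\<And>i. i \<in> I \<Longrightarrow> g i \<in> A"
  shows "h (sum g I) = (\<Sum>i\<in>I. h (g i))"
  using assms(3)
proof (induction I rule: infinite_finite_induct)
  case (insert i I)
  then have "sum g I \<in> A"
    by (intro m1.subspace_sum[OF assms(2)]) auto
  with insert show ?case
    by (simp add: lin_map_add[OF assms(1)])
qed (simp_all add: lin_map_zero[OF assms(1,2)])

lemma lin_map_eq_on_span:
  assumes "lin_map s1 (m1.span S) s2 B h" and "lin_map s1 (m1.span S) s2 C g"
    and "\<And>x. x \<in> S \<Longrightarrow> h x = g x" and "x \<in> m1.span S"
  shows "h x = g x"
proof -
  have "x \<in> m1.span S \<and> h x = g x"
    using assms(4)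
  proof (induction rule: m1.span_induct_alt)
    case base
    show ?case
      using lin_map_zero[OF assms(1)] lin_map_zero[OF assms(2)] by (simp add: m1.span_zero)
  next
    case (step c x y)
    then have "x \<in> m1.span S" "s1 c x \<in> m1.span S"
      by (simp_all add: m1.span_base m1.span_scale)
    with step assms(3) show ?case
      by (simp add: m1.span_add lin_map_add[OF assms(1)] lin_map_add[OF assms(2)]
          lin_map_scale[OF assms(1)] lin_map_scale[OF assms(2)])
  qed
  then show ?thesis ..
qed

lemma lin_iso_inv_into:
  assumes "lin_iso s1 A s2 B h" and "m1.subspace A"
  shows "lin_map s2 B s1 A (inv_into A h)"
proof -
  have lin: "lin_map s1 A s2 B h" and bij: "bij_betw h A B"
    using assms(1) by (simp_all add: lin_iso_def)
  have inA: "inv_into A h y \<in> A" and h: "h (inv_into A h y) = y" if "y \<in> B" for y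
    using bij that by (auto simp: bij_betw_def inv_into_into f_inv_into_f)
  have eq: "inv_into A h (h x) = x" if "x \<in> A" for x
    using bij that by (simp add: bij_betw_def)
  show ?thesis
  proof (rule lin_mapI)
    fix x y assume xy: "x \<in> B" "y \<in> B"
    have "inv_into A h (h (inv_into A h x + inv_into A h y)) = inv_into A h x + inv_into A h y"
      using xy by (intro eq m1.subspace_add[OF assms(2)] inA)
    then show "inv_into A h (x + y) = inv_into A h x + inv_into A h y"
      using xy by (simp add: lin_map_add[OF lin] inA h)
  next
    fix c x assume x: "x \<in> B"
    have "inv_into A h (h (s1 c (inv_into A h x))) = s1 c (inv_into A h x)"
      using x by (intro eq m1.subspace_scale[OF assms(2)] inA)
    then show "inv_into A h (s2 c x) = s1 c (inv_into A h x)"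
      using x by (simp add: lin_map_scale[OF lin] inA h)
  qed (rule inA)
qed

end

context module
begin

lemma direct_sumE:
  assumes "direct_sum scale A B C" and "x \<in> A"
  obtains b c where "b \<in> B" "c \<in> C" "x = b + c"
  using assms by (auto simp: direct_sum_def)

lemma proj_eqI:
  assumes "direct_sum scale A B C" and "b \<in> B" and "c \<in> C"
  shows "proj B C (b + c) = b"
  unfolding proj_def
proof (rule the_equality)
  fix b' assume "b' \<in> B \<and> (\<exists>c'\<in>C. b + c = b' + c')"
  then obtain c' where "b' \<in> B" "c' \<in> C" and eq: "b + c = b' + c'"
    by blast
  from eq have "b' - b = c - c'"
    by (simp add: algebra_simps)
  moreover have "b' - b \<in> B" "c - c' \<in> C"
    using assms \<open>b' \<in> B\<close> \<open>c' \<in> C\<close> by (auto simp: direct_sum_def intro: subspace_diff)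
  ultimately have "b' - b \<in> B \<inter> C"
    by simp
  then have "b' - b = 0"
    using assms(1) by (simp only: direct_sum_def singleton_iff)
  then show "b' = b"
    by simp
qed (use assms in auto)

lemma direct_sum_commute: "direct_sum scale A B C \<Longrightarrow> direct_sum scale A C B"
  unfolding direct_sum_def by (auto simp: add.commute) (metis add.commute)+

lemma lin_map_proj:
  assumes "direct_sum scale A B C"
  shows "lin_map scale A scale B (proj B C)"
proof -
  have sub: "subspace B" "subspace C"
    using assms by (simp_all add: direct_sum_def)
  show ?thesis
  proof (rule lin_mapI)
    fix x assume "x \<in> A"
    then show "proj B C x \<in> B"
      by (metis assms direct_sumE proj_eqI)
  next
    fix x y assume "x \<in> A" "y \<in> A"
    then obtain b c b' c' where *: "b \<in> B" "c \<in> C" "x = b + c" "b' \<in> B" "c' \<in> C" "y = b' + c'"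
      by (metis assms direct_sumE)
    then have "proj B C ((b + b') + (c + c')) = b + b'"
      by (intro proj_eqI[OF assms] subspace_add sub)
    with * show "proj B C (x + y) = proj B C x + proj B C y"
      by (simp add: proj_eqI[OF assms] algebra_simps)
  next
    fix k x assume "x \<in> A"
    then obtain b c where *: "b \<in> B" "c \<in> C" "x = b + c"
      by (metis assms direct_sumE)
    then have "proj B C (scale k b + scale k c) = scale k b"
      by (intro proj_eqI[OF assms] subspace_scale sub)
    with * show "proj B C (scale k x) = scale k (proj B C x)"
      by (simp add: proj_eqI[OF assms] scale_right_distrib)
  qed
qed

lemma proj_add_proj:
  assumes "direct_sum scale A B C" and "x \<in> A"
  shows "proj B C x + proj C B x = x"
proof -
  obtain b c where *: "b \<in> B" "c \<in> C" "x = b + c"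
    using assms by (rule direct_sumE)
  then have "proj C B (c + b) = c"
    by (intro proj_eqI[OF direct_sum_commute[OF assms(1)]])
  with * show ?thesis
    by (simp add: proj_eqI[OF assms(1)] add.commute)
qed

lemma proj_id: "direct_sum scale A B C \<Longrightarrow> b \<in> B \<Longrightarrow> proj B C b = b"
  using proj_eqI[of A B C b 0] by (auto simp: direct_sum_def subspace_0)

lemma proj_0: "direct_sum scale A B C \<Longrightarrow> c \<in> C \<Longrightarrow> proj B C c = 0"
  using proj_eqI[of A B C 0 c] by (auto simp: direct_sum_def subspace_0)

end


section \<open>Calculus in a DG-algebra\<close>

lemma (in module) subspace_free: "free_of_rank scale A n \<Longrightarrow> subspace A"
  by (auto simp: free_of_rank_def)

context dg_algebra
begin

sublocale scale_pair: module_pair "smul F" "smul F" ..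

lemma gr_subspace: "subspace (gr F i)"
  using free[of i] subspace_free by blast

lemma gr_closed [simp]:
  shows gr_zero: "0 \<in> gr F i"
    and gr_add: "x \<in> gr F i \<Longrightarrow> y \<in> gr F i \<Longrightarrow> x + y \<in> gr F i"
    and gr_diff: "x \<in> gr F i \<Longrightarrow> y \<in> gr F i \<Longrightarrow> x - y \<in> gr F i"
    and gr_neg: "x \<in> gr F i \<Longrightarrow> - x \<in> gr F i"
    and gr_scale: "x \<in> gr F i \<Longrightarrow> smul F c x \<in> gr F i"
  using gr_subspace[of i]
  by (auto intro: subspace_0 subspace_add subspace_diff subspace_neg subspace_scale)

lemma un_in [simp]: "un F \<in> gr F 0"
  using bij_betw_apply[OF deg0, of 1] by simp

text \<open>
  The degrees in the next rules are separate variables tied by an equation, so that the rules also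
  match when the degrees are numerals.
\<close>

lemma bd_in [simp]: "x \<in> gr F i \<Longrightarrow> i = Suc j \<Longrightarrow> bd F i x \<in> gr F j"
  using bd_hom by (auto dest: lin_map_in)

lemma mul_in [simp]: "x \<in> gr F i \<Longrightarrow> y \<in> gr F j \<Longrightarrow> n = i + j \<Longrightarrow> mul F i j x y \<in> gr F n"
  using mul_hom_left by (auto dest: lin_map_in)

lemma bd_lin: "lin_map (smul F) (gr F i) (smul F) (gr F (i - 1)) (bd F i)"
proof (cases i)
  case 0
  then show ?thesis
    by (auto intro!: lin_mapI simp: bd_0)
qed (simp add: bd_hom)

lemma bd_linear [simp]:
  shows bd_zero: "bd F i 0 = 0"
    and bd_add: "x \<in> gr F i \<Longrightarrow> y \<in> gr F i \<Longrightarrow> bd F i (x + y) = bd F i x + bd F i y"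
    and bd_diff: "x \<in> gr F i \<Longrightarrow> y \<in> gr F i \<Longrightarrow> bd F i (x - y) = bd F i x - bd F i y"
    and bd_neg: "x \<in> gr F i \<Longrightarrow> bd F i (- x) = - bd F i x"
    and bd_scale: "x \<in> gr F i \<Longrightarrow> bd F i (smul F c x) = smul F c (bd F i x)"
  by (rule scale_pair.lin_map_zero[OF bd_lin gr_subspace] lin_map_add[OF bd_lin]
      scale_pair.lin_map_diff[OF bd_lin gr_subspace] scale_pair.lin_map_neg[OF bd_lin]
      lin_map_scale[OF bd_lin]; assumption)+

lemma bd_bd' [simp]: "x \<in> gr F i \<Longrightarrow> i = Suc j \<Longrightarrow> bd F j (bd F i x) = 0"
  by (cases j) (auto simp: bd_bd bd_0)

lemma mul_left_linear [simp]:
  assumes "z \<in> gr F j"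
  shows mul_zero_left: "mul F i j 0 z = 0"
    and mul_add_left: "x \<in> gr F i \<Longrightarrow> y \<in> gr F i \<Longrightarrow>
          mul F i j (x + y) z = mul F i j x z + mul F i j y z"
    and mul_diff_left: "x \<in> gr F i \<Longrightarrow> y \<in> gr F i \<Longrightarrow>
          mul F i j (x - y) z = mul F i j x z - mul F i j y z"
    and mul_neg_left: "x \<in> gr F i \<Longrightarrow> mul F i j (- x) z = - mul F i j x z"
    and mul_scale_left: "x \<in> gr F i \<Longrightarrow> mul F i j (smul F c x) z = smul F c (mul F i j x z)"
  by (rule scale_pair.lin_map_zero[OF mul_hom_left gr_subspace] lin_map_add[OF mul_hom_left]
      scale_pair.lin_map_diff[OF mul_hom_left gr_subspace]
      scale_pair.lin_map_neg[OF mul_hom_left] lin_map_scale[OF mul_hom_left]; (rule assms | assumption))+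

lemma mul_right_linear [simp]:
  assumes "z \<in> gr F i"
  shows mul_zero_right: "mul F i j z 0 = 0"
    and mul_add_right: "x \<in> gr F j \<Longrightarrow> y \<in> gr F j \<Longrightarrow>
          mul F i j z (x + y) = mul F i j z x + mul F i j z y"
    and mul_diff_right: "x \<in> gr F j \<Longrightarrow> y \<in> gr F j \<Longrightarrow>
          mul F i j z (x - y) = mul F i j z x - mul F i j z y"
    and mul_neg_right: "x \<in> gr F j \<Longrightarrow> mul F i j z (- x) = - mul F i j z x"
    and mul_scale_right: "x \<in> gr F j \<Longrightarrow> mul F i j z (smul F c x) = smul F c (mul F i j z x)"
  by (rule scale_pair.lin_map_zero[OF mul_hom_right gr_subspace] lin_map_add[OF mul_hom_right]
      scale_pair.lin_map_diff[OF mul_hom_right gr_subspace]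
      scale_pair.lin_map_neg[OF mul_hom_right] lin_map_scale[OF mul_hom_right]; (rule assms | assumption))+

lemma scalar_smul_un [simp]: "scalar F (smul F p (un F)) = p"
  unfolding scalar_def using deg0 by (auto simp: bij_betw_def inj_on_def)

lemma smul_scalar:
  assumes "x \<in> gr F 0"
  shows "smul F (scalar F x) (un F) = x"
proof -
  obtain p where "x = smul F p (un F)"
    using deg0 assms unfolding bij_betw_def by blast
  then show ?thesis
    by simp
qed

lemma scalar_mul:
  assumes "x \<in> gr F 0" and "y \<in> gr F i"
  shows "mul F 0 i x y = smul F (scalar F x) y"
proof -
  have "mul F 0 i (smul F (scalar F x) (un F)) y = smul F (scalar F x) y"
    by (simp only: mul_scale_left[OF assms(2) un_in] mul_un_left[OF assms(2)])
  then show ?thesis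
    by (simp add: smul_scalar assms(1))
qed

lemma mul_scalar:
  assumes "x \<in> gr F i" and "y \<in> gr F 0"
  shows "mul F i 0 x y = smul F (scalar F y) x"
proof -
  have "mul F i 0 x (smul F (scalar F y) (un F)) = smul F (scalar F y) x"
    by (simp only: mul_scale_right[OF assms(1) un_in] mul_un_right[OF assms(1)])
  then show ?thesis
    by (simp add: smul_scalar assms(2))
qed

lemma mul_assoc':
  "\<lbrakk>x \<in> gr F i; y \<in> gr F j; z \<in> gr F k; ij = i + j; jk = j + k\<rbrakk> \<Longrightarrow>
     mul F ij k (mul F i j x y) z = mul F i jk x (mul F j k y z)"
  using mul_assoc by simp

text \<open>
  The Leibniz rule, read as a homotopy: multiplication by \<open>\<tau>\<close> contracts, up to signs, the scalar
  multiplication by \<open>d(\<tau>)\<close>.  This is how the summand \<open>k\<^sub>1(\<sigma>)\<close> of \<open>f\<close> comes about.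
\<close>

lemma bd_rmul:
  assumes "\<theta> \<in> gr F i" and "\<tau> \<in> gr F 1" and "0 < i"
  shows "bd F (i + 1) (rmul F \<tau> i \<theta>) =
           rmul F \<tau> (i - 1) (bd F i \<theta>) + smul F ((-1) ^ i * scalar F (bd F 1 \<tau>)) \<theta>"
  using leibniz[OF assms(1,2)] assms by (simp add: rmul_def mul_scalar)

lemma rmul_rmul: 
  assumes "\<theta> \<in> gr F i" and "\<tau> \<in> gr F 1" and "j = Suc i"
  shows "rmul F \<tau> j (rmul F \<tau> i \<theta>) = 0"
  using assms mul_assoc[OF assms(1,2,2)] odd_square[OF assms(2)] by (simp add: rmul_def)

text \<open>
  Above the top degree every product is zero, so that the Leibniz rule moves the differential from
  one factor to the other.
\<close>

lemma bd_adjoint: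
  assumes "gr F (i + j) = {0}" and "x \<in> gr F i" and "y \<in> gr F j" and "0 < i" and "0 < j"
  shows "mul F (i - 1) j (bd F i x) y = smul F ((-1) ^ (i - 1)) (mul F i (j - 1) x (bd F j y))"
proof -
  have "mul F i j x y \<in> gr F (i + j)"
    by (rule mul_in[OF assms(2,3) refl])
  then have "mul F i j x y = 0"
    by (simp only: assms(1) singleton_iff)
  then have "mul F (i - 1) j (bd F i x) y + smul F ((-1) ^ i) (mul F i (j - 1) x (bd F j y)) = 0"
    using leibniz[OF assms(2,3)] by simp
  moreover have "(-1 :: 'p) ^ i = - ((-1) ^ (i - 1))"
    using assms(4) by (cases i) simp_all
  ultimately show ?thesis
    by (simp add: add_eq_0_iff2)
qed

end


section \<open>Koszul complexes exhibit Poincare duality\<close>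

context dg_algebra
begin

lemma wedge_list_in:
  "(\<And>i. i \<in> set xs \<Longrightarrow> e i \<in> gr F 1) \<Longrightarrow> length xs = n \<Longrightarrow> wedge_list F e xs \<in> gr F n"
  by (induction xs arbitrary: n) auto

lemma wedge_list_append:
  assumes "\<And>i. i \<in> set (xs @ ys) \<Longrightarrow> e i \<in> gr F 1"
  shows "wedge_list F e (xs @ ys) =
           mul F (length xs) (length ys) (wedge_list F e xs) (wedge_list F e ys)"
  using assms
proof (induction xs)
  case Nil
  then show ?case
    by (simp add: mul_un_left wedge_list_in)
next
  case (Cons x xs)
  then show ?case
    using mul_assoc[of "e x" 1 "wedge_list F e xs" "length xs" "wedge_list F e ys" "length ys"]
    by (simp add: wedge_list_in)
qed

lemma wedge_list_swap:
  assumes "\<And>i. i \<in> set (x # y # zs) \<Longrightarrow> e i \<in> gr F 1"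
  shows "wedge_list F e (x # y # zs) = - wedge_list F e (y # x # zs)"
proof -
  have in1: "e x \<in> gr F 1" "e y \<in> gr F 1" and w: "wedge_list F e zs \<in> gr F (length zs)"
    using assms by (auto simp: wedge_list_in)
  have "mul F 1 1 (e x) (e y) = - mul F 1 1 (e y) (e x)"
    using graded_comm[OF in1] by simp
  moreover have "mul F 1 1 (e y) (e x) \<in> gr F (1 + 1)"
    using in1 by simp
  ultimately show ?thesis
    using mul_assoc[OF in1 w] mul_assoc[OF in1(2,1) w] w by simp
qed

lemma wedge_list_repeat:
  assumes "x \<in> set xs" and "\<And>i. i \<in> set xs \<Longrightarrow> e i \<in> gr F 1"
  shows "wedge_list F e (x # xs) = 0"
  using assms
proof (induction xs)
  case (Cons y ys)
  show ?case
  proof (cases "x = y")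
    case True
    with Cons.prems show ?thesis
      using mul_assoc[of "e y" 1 "e y" 1 "wedge_list F e ys" "length ys"] odd_square[of "e y" 1]
      by (simp add: wedge_list_in)
  next
    case False
    with Cons show ?thesis
      using wedge_list_swap[of x y ys e] by auto
  qed
qed simp

lemma wedge_list_not_distinct:
  assumes "\<not> distinct xs" and "\<And>i. i \<in> set xs \<Longrightarrow> e i \<in> gr F 1"
  shows "wedge_list F e xs = 0"
  using assms
proof (induction xs)
  case (Cons x xs)
  then show ?case
    by (cases "x \<in> set xs") (auto simp: wedge_list_repeat simp del: wedge_list.simps(2), simp)
qed simp

text \<open>
  Sorting is by transpositions of neighbours, each of which changes the sign; what is recorded of
  the sign is that it is a unit.
\<close>

lemma wedge_list_insort:
  assumes "\<And>i. i \<in> set (x # xs) \<Longrightarrow> e i \<in> gr F 1"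
  shows "\<exists>c\<in>{1, -1}. wedge_list F e (x # xs) = smul F c (wedge_list F e (insort x xs))"
  using assms
proof (induction xs)
  case (Cons y ys)
  show ?case
  proof (cases "x \<le> y")
    case False
    from Cons obtain c where c: "c \<in> {1, -1}"
      and eq: "wedge_list F e (x # ys) = smul F c (wedge_list F e (insort x ys))"
      by (metis (no_types, lifting) insert_iff list.simps(15))
    have in': "wedge_list F e (insort x ys) \<in> gr F (Suc (length ys))"
      using Cons.prems by (auto intro!: wedge_list_in simp: set_insort_key)
    have "wedge_list F e (x # y # ys) = - mul F 1 (Suc (length ys)) (e y) (wedge_list F e (x # ys))"
      using wedge_list_swap[of x y ys e] Cons.prems by simp
    also have "\<dots> = smul F (- c) (wedge_list F e (y # insort x ys))"
      using eq in' Cons.prems by simp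
    finally show ?thesis
      using c False by (intro bexI[of _ "- c"]) auto
  qed auto
qed simp

lemma wedge_list_sort:
  assumes "\<And>i. i \<in> set xs \<Longrightarrow> e i \<in> gr F 1"
  shows "\<exists>c\<in>{1, -1}. wedge_list F e xs = smul F c (wedge_list F e (sort xs))"
  using assms
proof (induction xs)
  case (Cons x xs)
  then obtain c where c: "c \<in> {1, -1}"
    and eq: "wedge_list F e xs = smul F c (wedge_list F e (sort xs))"
    by (meson list.set_intros(2))
  obtain c' where c': "c' \<in> {1, -1}" and eq':
    "wedge_list F e (x # sort xs) = smul F c' (wedge_list F e (insort x (sort xs)))"
    using wedge_list_insort[of x "sort xs" e] Cons.prems by (metis list.simps(15) set_sort)
  have "wedge_list F e (sort xs) \<in> gr F (length xs)"
    using Cons.prems by (intro wedge_list_in) auto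
  then have "wedge_list F e (x # xs) = smul F c (wedge_list F e (x # sort xs))"
    using eq Cons.prems by simp
  also have "\<dots> = smul F (c * c') (wedge_list F e (sort (x # xs)))"
    using eq' by simp
  finally show ?case
    using c c' by (intro bexI[of _ "c * c'"]) auto
qed simp

lemma wedge_set_mul_disjoint:
  assumes "finite S" "finite T" "S \<inter> T = {}" and "\<And>i. i \<in> S \<union> T \<Longrightarrow> e i \<in> gr F 1"
  shows "\<exists>c\<in>{1, -1}. mul F (card S) (card T)
           (wedge_list F e (sorted_list_of_set S)) (wedge_list F e (sorted_list_of_set T)) =
           smul F c (wedge_list F e (sorted_list_of_set (S \<union> T)))"
proof -
  let ?xs = "sorted_list_of_set S @ sorted_list_of_set T"
  have "sort ?xs = sorted_list_of_set (S \<union> T)"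
    using assms(1-3) by (intro sorted_distinct_set_unique) auto
  moreover have "\<And>i. i \<in> set ?xs \<Longrightarrow> e i \<in> gr F 1"
    using assms by auto
  ultimately show ?thesis
    using wedge_list_sort[of ?xs e] wedge_list_append[of "sorted_list_of_set S"
        "sorted_list_of_set T" e] by simp
qed

lemma wedge_set_mul_meet:
  assumes "finite S" "finite T" "S \<inter> T \<noteq> {}" and "\<And>i. i \<in> S \<union> T \<Longrightarrow> e i \<in> gr F 1"
  shows "mul F (card S) (card T)
           (wedge_list F e (sorted_list_of_set S)) (wedge_list F e (sorted_list_of_set T)) = 0"
proof -
  let ?xs = "sorted_list_of_set S @ sorted_list_of_set T"
  have "\<not> distinct ?xs" and "\<And>i. i \<in> set ?xs \<Longrightarrow> e i \<in> gr F 1"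
    using assms by auto
  then show ?thesis
    using wedge_list_not_distinct[of ?xs e] wedge_list_append[of "sorted_list_of_set S"
        "sorted_list_of_set T" e] by simp
qed

text \<open>
  By graded commutativity the second half of perfectness is the first half with the two degrees
  exchanged.
\<close>

lemma perfect_pairingI:
  assumes left: "\<And>i j h. i + j = n \<Longrightarrow> lin_map (smul F) (gr F j) (smul F) (gr F n) h \<Longrightarrow>
      \<exists>!x. x \<in> gr F i \<and> (\<forall>y\<in>gr F j. mul F i j x y = h y)"
    and ij: "i + j = n"
  shows "perfect_pairing (smul F) (gr F i) (gr F j) (gr F n) (mul F i j)"
  unfolding perfect_pairing_def
proof (intro conjI allI impI)
  fix h assume "lin_map (smul F) (gr F j) (smul F) (gr F n) h"
  then show "\<exists>!x. x \<in> gr F i \<and> (\<forall>y\<in>gr F j. mul F i j x y = h y)"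
    by (rule left[OF ij])
next
  fix h assume h: "lin_map (smul F) (gr F i) (smul F) (gr F n) h"
  have "lin_map (smul F) (gr F i) (smul F) (gr F n) (\<lambda>x. smul F ((-1) ^ (i * j)) (h x))"
    by (rule lin_mapI)
      (simp_all add: lin_map_in[OF h] lin_map_add[OF h] lin_map_scale[OF h]
        scale_right_distrib scale_left_commute del: scale_scale)
  then have "\<exists>!y. y \<in> gr F j \<and> (\<forall>x\<in>gr F i. mul F j i y x = smul F ((-1) ^ (i * j)) (h x))"
    using ij by (intro left) auto
  moreover have "mul F j i y x = smul F ((-1) ^ (i * j)) (h x) \<longleftrightarrow> mul F i j x y = h x"
    if "x \<in> gr F i" "y \<in> gr F j" for x y
  proof -
    have inv: "smul F ((-1) ^ (i * j)) (smul F ((-1) ^ (i * j)) z) = z" for z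
      by (simp flip: power_add mult_2)
    show ?thesis
      using graded_comm[OF that] inv by metis
  qed
  ultimately show "\<exists>!y. y \<in> gr F j \<and> (\<forall>x\<in>gr F i. mul F i j x y = h x)"
    by (simp cong: conj_cong)
qed

end

text \<open>
  A Koszul complex together with the basis \<open>e\<close> of its component of degree one; the assumptions are
  those of \<^const>\<open>koszul_complex\<close> with the witness \<open>e\<close> made explicit.
\<close>

locale koszul_basis = dg_algebra F
  for F :: "('p::comm_ring_1, 'm::ab_group_add, 'z) dg_scheme" +
  fixes n :: nat and e :: "nat \<Rightarrow> 'm"
  assumes e_in: "j < n \<Longrightarrow> e j \<in> gr F 1"
    and inj: "inj_on (\<lambda>S. wedge_list F e (sorted_list_of_set S)) {S. S \<subseteq> {..<n} \<and> card S = i}"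
    and indep: "\<not> dependent ((\<lambda>S. wedge_list F e (sorted_list_of_set S)) `
                  {S. S \<subseteq> {..<n} \<and> card S = i})"
    and spans: "span ((\<lambda>S. wedge_list F e (sorted_list_of_set S)) `
                  {S. S \<subseteq> {..<n} \<and> card S = i}) = gr F i"
begin

abbreviation subsets :: "nat \<Rightarrow> nat set set" where
  "subsets i \<equiv> {S. S \<subseteq> {..<n} \<and> card S = i}"

abbreviation w :: "nat set \<Rightarrow> 'm" where
  "w S \<equiv> wedge_list F e (sorted_list_of_set S)"

lemma finite_subsets [simp]: "finite (subsets i)"
  by (rule finite_subset[of _ "Pow {..<n}"]) auto

lemma w_in: "S \<in> subsets i \<Longrightarrow> w S \<in> gr F i"
  using spans[of i] span_base[of "w S" "w ` subsets i"] by blast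

lemma expand:
  assumes "x \<in> gr F i"
  obtains d where "x = (\<Sum>S\<in>subsets i. smul F (d S) (w S))"
proof -
  have "x \<in> range (\<lambda>u. \<Sum>v\<in>w ` subsets i. smul F (u v) v)"
    using assms spans[of i] span_finite[of "w ` subsets i"] by simp
  then obtain u where "x = (\<Sum>v\<in>w ` subsets i. smul F (u v) v)"
    by blast
  then have "x = (\<Sum>S\<in>subsets i. smul F (u (w S)) (w S))"
    by (simp add: sum.reindex[OF inj])
  then show ?thesis
    by (rule that)
qed

lemma subsets_top: "subsets n = {{..<n}}"
  by (auto dest: card_subset_eq[rotated])

lemma image_top: "w ` subsets n = {w {..<n}}"
  unfolding subsets_top by simp

lemma gr_top: "gr F n = range (\<lambda>p. smul F p (w {..<n}))"
  using spans[of n] unfolding image_top span_singleton by (rule sym)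

lemma top_free:
  assumes "smul F p (w {..<n}) = 0"
  shows "p = 0"
proof -
  have "independent {w {..<n}}"
    using indep[of n] unfolding image_top .
  then show ?thesis
    using independentD[of "{w {..<n}}" "{w {..<n}}" "\<lambda>_. p" "w {..<n}"] assms by simp
qed

lemma gr_above: "n < i \<Longrightarrow> gr F i = {0}"
proof -
  assume "n < i"
  then have "subsets i = {}"
    using card_mono[of "{..<n}"] by (auto simp: not_le[symmetric])
  then show ?thesis
    using spans[of i] by (simp only: image_empty span_empty)
qed

text \<open>
  The basis products of complementary degree are dual to each other up to sign: a product is zero
  unless the two index sets are complementary.
\<close>

lemma dual_basis:
  assumes "i + j = n"
  shows "\<exists>\<epsilon>. (\<forall>T. \<epsilon> T * \<epsilon> T = 1) \<and>
           (\<forall>d. \<forall>T\<in>subsets j. mul F i j (\<Sum>S\<in>subsets i. smul F (d S) (w S)) (w T) =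
              smul F (d ({..<n} - T) * \<epsilon> T) (w {..<n}))"
proof -
  have compl: "{..<n} - T \<in> subsets i" if "T \<in> subsets j" for T
    using that assms by (auto simp: card_Diff_subset finite_subset[of T "{..<n}"])
  have "\<exists>c. c * c = 1 \<and> (T \<in> subsets j \<longrightarrow> mul F i j (w ({..<n} - T)) (w T) = smul F c (w {..<n}))"
    for T
  proof (cases "T \<in> subsets j")
    case True
    then have fin: "finite T" "card T = j" "card ({..<n} - T) = i" "{..<n} - T \<union> T = {..<n}"
      using compl[OF True] by (auto intro: finite_subset)
    have "\<exists>c\<in>{1, -1}. mul F (card ({..<n} - T)) (card T) (w ({..<n} - T)) (w T) =
        smul F c (w ({..<n} - T \<union> T))"
      using fin e_in by (intro wedge_set_mul_disjoint) auto
    then obtain c where "c \<in> {1, -1}" "mul F i j (w ({..<n} - T)) (w T) = smul F c (w {..<n})"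
      unfolding fin by blast
    then show ?thesis
      by (intro exI[of _ c]) auto
  qed (auto intro: exI[of _ 1])
  then have "\<exists>\<epsilon>. \<forall>T. \<epsilon> T * \<epsilon> T = 1 \<and>
      (T \<in> subsets j \<longrightarrow> mul F i j (w ({..<n} - T)) (w T) = smul F (\<epsilon> T) (w {..<n}))"
    by (intro choice allI)
  then obtain \<epsilon> where \<epsilon>: "\<And>T. \<epsilon> T * \<epsilon> T = 1"
    and top: "\<And>T. T \<in> subsets j \<Longrightarrow> mul F i j (w ({..<n} - T)) (w T) = smul F (\<epsilon> T) (w {..<n})"
    by blast
  have "mul F i j (\<Sum>S\<in>subsets i. smul F (d S) (w S)) (w T) =
      smul F (d ({..<n} - T) * \<epsilon> T) (w {..<n})" if T: "T \<in> subsets j" for d T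
  proof -
    have zero: "mul F i j (w S) (w T) = 0" if "S \<in> subsets i" "S \<noteq> {..<n} - T" for S
    proof -
      have fin: "finite S" "finite T" "card S = i" "card T = j"
        using that T by (auto intro: finite_subset)
      have "S \<inter> T \<noteq> {}"
      proof
        assume "S \<inter> T = {}"
        then have "S \<subseteq> {..<n} - T"
          using that by auto
        moreover have "card S = card ({..<n} - T)"
          using that(1) compl[OF T] by simp
        ultimately have "S = {..<n} - T"
          by (intro card_subset_eq) auto
        with that(2) show False ..
      qed
      then show ?thesis
        using wedge_set_mul_meet[OF fin(1,2), of e] e_in that(1) T fin by auto
    qed
    have "mul F i j (\<Sum>S\<in>subsets i. smul F (d S) (w S)) (w T) =
        (\<Sum>S\<in>subsets i. mul F i j (smul F (d S) (w S)) (w T))"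
      by (rule scale_pair.lin_map_sum[OF mul_hom_left[OF w_in[OF T]] gr_subspace])
        (rule gr_scale[OF w_in])
    also have "\<dots> = (\<Sum>S\<in>subsets i. if S = {..<n} - T then
        smul F (d ({..<n} - T) * \<epsilon> T) (w {..<n}) else 0)"
      by (rule sum.cong) (auto simp: w_in[OF T] w_in zero top[OF T] simp del: mem_Collect_eq)
    also have "\<dots> = smul F (d ({..<n} - T) * \<epsilon> T) (w {..<n})"
      using compl[OF T] by (simp add: sum.delta del: mem_Collect_eq)
    finally show ?thesis .
  qed
  with \<epsilon> show ?thesis
    by blast
qed

text \<open>
  Hence a functional on the component of degree \<open>j\<close> is multiplication by the element whose
  coordinates are, up to sign, its values on the complementary basis products, and by no other.
\<close>

lemma perfect_left:
  assumes "i + j = n" and h: "lin_map (smul F) (gr F j) (smul F) (gr F n) h"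
  shows "\<exists>!x. x \<in> gr F i \<and> (\<forall>y\<in>gr F j. mul F i j x y = h y)"
proof -
  obtain \<epsilon> where \<epsilon>: "\<And>T. \<epsilon> T * \<epsilon> T = 1"
    and dual: "\<And>d T. T \<in> subsets j \<Longrightarrow> mul F i j (\<Sum>S\<in>subsets i. smul F (d S) (w S)) (w T) =
           smul F (d ({..<n} - T) * \<epsilon> T) (w {..<n})"
    using dual_basis[OF assms(1)] by blast
  have compl: "{..<n} - S \<in> subsets j" "{..<n} - ({..<n} - S) = S" if "S \<in> subsets i" for S
    using that assms(1) by (auto simp: card_Diff_subset finite_subset[of S "{..<n}"])
  have "\<exists>p. h (w T) = smul F p (w {..<n})" if "T \<in> subsets j" for T
    using lin_map_in[OF h w_in[OF that]] gr_top by auto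
  then obtain c where c: "\<And>T. T \<in> subsets j \<Longrightarrow> h (w T) = smul F (c T) (w {..<n})"
    by metis
  let ?x = "\<Sum>S\<in>subsets i. smul F (c ({..<n} - S) * \<epsilon> ({..<n} - S)) (w S)"
  have x: "?x \<in> gr F i"
    by (intro subspace_sum[OF gr_subspace] gr_scale w_in)
  have h_basis: "mul F i j ?x (w T) = h (w T)" if "T \<in> subsets j" for T
  proof -
    have "{..<n} - ({..<n} - T) = T"
      using that by auto
    then show ?thesis
      using dual[OF that, of "\<lambda>S. c ({..<n} - S) * \<epsilon> ({..<n} - S)"] c[OF that] \<epsilon>[of T]
      by (simp add: mult.assoc)
  qed
  have lin: "lin_map (smul F) (span (w ` subsets j)) (smul F) (gr F (i + j)) (mul F i j ?x)"
    "lin_map (smul F) (span (w ` subsets j)) (smul F) (gr F n) h"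
    unfolding spans by (rule mul_hom_right[OF x], rule h)
  have "mul F i j ?x y = h y" if "y \<in> gr F j" for y
  proof (rule scale_pair.lin_map_eq_on_span[OF lin])
    show "y \<in> span (w ` subsets j)"
      unfolding spans by (rule that)
    show "mul F i j ?x v = h v" if "v \<in> w ` subsets j" for v
      using that h_basis by blast
  qed
  moreover have "x' = ?x" if "x' \<in> gr F i" "\<forall>y\<in>gr F j. mul F i j x' y = h y" for x'
  proof -
    obtain d where d: "x' = (\<Sum>S\<in>subsets i. smul F (d S) (w S))"
      using \<open>x' \<in> gr F i\<close> by (rule expand)
    have "d S = c ({..<n} - S) * \<epsilon> ({..<n} - S)" if S: "S \<in> subsets i" for S
    proof -
      have "smul F (d S * \<epsilon> ({..<n} - S)) (w {..<n}) = smul F (c ({..<n} - S)) (w {..<n})"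
        using dual[OF compl(1)[OF S], of d] compl(2)[OF S] c[OF compl(1)[OF S]]
          \<open>\<forall>y\<in>gr F j. mul F i j x' y = h y\<close> w_in[OF compl(1)[OF S]] d by metis
      then have "d S * \<epsilon> ({..<n} - S) - c ({..<n} - S) = 0"
        by (intro top_free) (simp add: scale_left_diff_distrib)
      then show ?thesis
        using \<epsilon>[of "{..<n} - S"] by (metis eq_iff_diff_eq_0 mult.assoc mult.right_neutral)
    qed
    with d show ?thesis
      by simp
  qed
  ultimately show ?thesis
    using x by blast
qed

lemma poincare_duality: "poincare_duality F n"
proof -
  let ?t = "\<lambda>p. smul F p (w {..<n})"
  have inj: "inj ?t"
  proof (rule injI)
    fix p q assume "?t p = ?t q"
    then have "?t (p - q) = 0"
      by (simp add: scale_left_diff_distrib)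
    then have "p - q = 0"
      by (rule top_free)
    then show "p = q"
      by simp
  qed
  have t: "lin_iso (*) UNIV (smul F) (gr F n) ?t"
    using inj by (auto simp: lin_iso_def bij_betw_def gr_top scale_left_distrib intro!: lin_mapI)
  interpret m: module_pair "(*)" "smul F"
    by (intro module_pair.intro module_mult module_axioms)
  have "lin_map (smul F) (gr F n) (*) UNIV (inv_into UNIV ?t)"
    by (rule m.lin_iso_inv_into[OF t]) simp
  moreover have "bij_betw (inv_into UNIV ?t) (gr F n) UNIV"
    using t by (simp add: lin_iso_def bij_betw_inv_into)
  ultimately have "lin_iso (smul F) (gr F n) (*) UNIV (inv_into UNIV ?t)"
    by (simp add: lin_iso_def)
  then have "\<exists>h. lin_iso (smul F) (gr F n) (*) UNIV h"
    by (rule exI[where x = "inv_into UNIV ?t"])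
  moreover have "perfect_pairing (smul F) (gr F i) (gr F (n - i)) (gr F n) (mul F i (n - i))"
    if "i \<le> n" for i
  proof (rule perfect_pairingI)
    show "i + (n - i) = n"
      using that by simp
  qed (rule perfect_left)
  ultimately show ?thesis
    unfolding poincare_duality_def using gr_above by simp
qed

end

lemma koszul_complex_poincare_duality:
  assumes "koszul_complex F n"
  shows "poincare_duality F n"
proof -
  have "\<exists>e. koszul_basis F n e"
    using assms
    by (simp only: koszul_complex_def koszul_basis_def koszul_basis_axioms_def Let_def
        all_conj_distrib ex_simps simp_thms conj_assoc)
  then show ?thesis
    using koszul_basis.poincare_duality by blast
qed

section \<open>Oriented Poincare algebras and dual maps\<close>

locale oriented_dg_algebra = dg_algebra F
  for F :: "('p::comm_ring_1, 'm::ab_group_add, 'z) dg_scheme" +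
  fixes n :: nat and ori :: "'m \<Rightarrow> 'p"
  assumes duality: "poincare_duality F n"
    and orientation: "lin_iso (smul F) (gr F n) (*) UNIV ori"
begin

lemma gr_above: "n < i \<Longrightarrow> gr F i = {0}"
  using duality by (simp add: poincare_duality_def)

lemma perfect:
  assumes "i + j = n"
  shows "perfect_pairing (smul F) (gr F i) (gr F j) (gr F n) (mul F i j)"
proof -
  have "i \<le> n" "n - i = j"
    using assms by simp_all
  moreover have "\<forall>i\<le>n. perfect_pairing (smul F) (gr F i) (gr F (n - i)) (gr F n) (mul F i (n - i))"
    using duality by (simp add: poincare_duality_def)
  ultimately show ?thesis
    by metis
qed

lemma ori_lin: "lin_map (smul F) (gr F n) (*) UNIV ori"
  using orientation by (simp add: lin_iso_def)

lemma ori_scale: "x \<in> gr F n \<Longrightarrow> ori (smul F c x) = c * ori x"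
  by (rule lin_map_scale[OF ori_lin])

lemma ori_eq_iff: "x \<in> gr F n \<Longrightarrow> y \<in> gr F n \<Longrightarrow> ori x = ori y \<longleftrightarrow> x = y"
  using orientation by (auto simp: lin_iso_def bij_betw_def inj_on_def)

lemma pairing_eqI:
  assumes "i + j = n" and "x \<in> gr F i" and "y \<in> gr F i"
    and eq: "\<And>z. z \<in> gr F j \<Longrightarrow> mul F i j x z = mul F i j y z"
  shows "x = y"
proof -
  have "perfect_pairing (smul F) (gr F i) (gr F j) (gr F n) (mul F i j)"
    by (rule perfect[OF assms(1)])
  moreover have "lin_map (smul F) (gr F j) (smul F) (gr F n) (mul F i j x)"
    using mul_hom_right[OF assms(2), of j] assms(1) by simp
  ultimately have "\<exists>!u. u \<in> gr F i \<and> (\<forall>z\<in>gr F j. mul F i j u z = mul F i j x z)"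
    by (simp add: perfect_pairing_def)
  then show ?thesis
    using assms(2,3) eq by metis
qed

text \<open>Perfectness of the pairing, with the top component identified with the ring.\<close>

lemma represent:
  assumes "i + j = n" and h: "lin_map (smul F) (gr F j) (*) UNIV h"
  obtains x where "x \<in> gr F i" and "\<And>z. z \<in> gr F j \<Longrightarrow> ori (mul F i j x z) = h z"
proof -
  interpret mp: module_pair "smul F" "(*)"
    by (intro module_pair.intro module_mult module_axioms)
  let ?o = "inv_into (gr F n) ori"
  have o: "lin_map (*) UNIV (smul F) (gr F n) ?o"
    by (rule mp.lin_iso_inv_into[OF orientation gr_subspace])
  have oo: "ori (?o p) = p" for p
    using orientation by (auto simp: lin_iso_def bij_betw_def intro: f_inv_into_f)
  have "lin_map (smul F) (gr F j) (smul F) (gr F n) (\<lambda>z. ?o (h z))"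
    by (rule lin_mapI) (simp_all add: lin_map_add[OF h] lin_map_scale[OF h] lin_map_in[OF o]
        lin_map_add[OF o] lin_map_scale[OF o])
  moreover have "perfect_pairing (smul F) (gr F i) (gr F j) (gr F n) (mul F i j)"
    by (rule perfect[OF assms(1)])
  ultimately have "\<exists>!x. x \<in> gr F i \<and> (\<forall>z\<in>gr F j. mul F i j x z = ?o (h z))"
    by (simp add: perfect_pairing_def)
  then obtain x where "x \<in> gr F i" "\<forall>z\<in>gr F j. mul F i j x z = ?o (h z)"
    by blast
  then show ?thesis
    using that oo by simp
qed

end

text \<open>
  The setting in which \<^const>\<open>dual_map\<close> makes sense: a homomorphism \<open>\<alpha>\<close> of DG-algebras with Poincare
  duality in degree four, and an orientation on either side.
\<close>

locale dual_pair =
  K: oriented_dg_algebra K 4 oK + M: oriented_dg_algebra M 4 oM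
  for K :: "('p::comm_ring_1, 'k::ab_group_add, 'y) dg_scheme" and oK
    and M :: "('p, 'm::ab_group_add, 'z) dg_scheme" and oM +
  fixes \<alpha> :: "nat \<Rightarrow> 'k \<Rightarrow> 'm"
  assumes alpha_lin: "lin_map (smul K) (gr K i) (smul M) (gr M i) (\<alpha> i)"
    and alpha_bd': "x \<in> gr K (Suc i) \<Longrightarrow> bd M (Suc i) (\<alpha> (Suc i) x) = \<alpha> i (bd K (Suc i) x)"
    and alpha_un: "\<alpha> 0 (un K) = un M"
    and alpha_mul': "x \<in> gr K i \<Longrightarrow> y \<in> gr K j \<Longrightarrow>
          \<alpha> (i + j) (mul K i j x y) = mul M i j (\<alpha> i x) (\<alpha> j y)"
begin

sublocale KM: module_pair "smul K" "smul M" ..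

lemma alpha_linear [simp]:
  shows alpha_in: "x \<in> gr K i \<Longrightarrow> \<alpha> i x \<in> gr M i"
    and alpha_zero: "\<alpha> i 0 = 0"
    and alpha_add: "x \<in> gr K i \<Longrightarrow> y \<in> gr K i \<Longrightarrow> \<alpha> i (x + y) = \<alpha> i x + \<alpha> i y"
    and alpha_diff: "x \<in> gr K i \<Longrightarrow> y \<in> gr K i \<Longrightarrow> \<alpha> i (x - y) = \<alpha> i x - \<alpha> i y"
    and alpha_neg: "x \<in> gr K i \<Longrightarrow> \<alpha> i (- x) = - \<alpha> i x"
    and alpha_scale: "x \<in> gr K i \<Longrightarrow> \<alpha> i (smul K c x) = smul M c (\<alpha> i x)"
  by (rule lin_map_in[OF alpha_lin] KM.lin_map_zero[OF alpha_lin K.gr_subspace]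
      lin_map_add[OF alpha_lin] KM.lin_map_diff[OF alpha_lin K.gr_subspace]
      KM.lin_map_neg[OF alpha_lin] lin_map_scale[OF alpha_lin]; assumption)+

lemma alpha_bd: "x \<in> gr K i \<Longrightarrow> i = Suc j \<Longrightarrow> bd M i (\<alpha> i x) = \<alpha> j (bd K i x)"
  using alpha_bd' by simp

lemma alpha_mul:
  "x \<in> gr K i \<Longrightarrow> y \<in> gr K j \<Longrightarrow> n = i + j \<Longrightarrow>
     mul M i j (\<alpha> i x) (\<alpha> j y) = \<alpha> n (mul K i j x y)"
  using alpha_mul' by simp

abbreviation \<beta> :: "nat \<Rightarrow> 'm \<Rightarrow> 'k" where
  "\<beta> \<equiv> dual_map K M oK oM \<alpha>"

lemma beta_ex1:
  assumes "i + j = 4" and "\<theta> \<in> gr M i"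
  shows "\<exists>!\<psi>. \<psi> \<in> gr K i \<and> (\<forall>\<phi>\<in>gr K j. oK (mul K i j \<psi> \<phi>) = oM (mul M i j \<theta> (\<alpha> j \<phi>)))"
proof -
  let ?h = "\<lambda>\<phi>. oM (mul M i j \<theta> (\<alpha> j \<phi>))"
  have "lin_map (smul K) (gr K j) (*) UNIV ?h"
    by (rule lin_mapI)
      (use assms in \<open>simp_all add: lin_map_add[OF M.ori_lin] lin_map_scale[OF M.ori_lin]\<close>)
  then obtain \<psi> where "\<psi> \<in> gr K i" "\<And>\<phi>. \<phi> \<in> gr K j \<Longrightarrow> oK (mul K i j \<psi> \<phi>) = ?h \<phi>"
    using K.represent[OF assms(1)] by metis
  moreover have "\<psi>' = \<psi>''" if "\<psi>' \<in> gr K i" "\<forall>\<phi>\<in>gr K j. oK (mul K i j \<psi>' \<phi>) = ?h \<phi>"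
    "\<psi>'' \<in> gr K i" "\<forall>\<phi>\<in>gr K j. oK (mul K i j \<psi>'' \<phi>) = ?h \<phi>" for \<psi>' \<psi>''
  proof (rule K.pairing_eqI[OF assms(1) that(1,3)])
    fix \<phi> assume \<phi>: "\<phi> \<in> gr K j"
    then have "oK (mul K i j \<psi>' \<phi>) = oK (mul K i j \<psi>'' \<phi>)"
      using that by simp
    moreover have "mul K i j \<psi>' \<phi> \<in> gr K 4" "mul K i j \<psi>'' \<phi> \<in> gr K 4"
      using \<phi> that assms(1) by simp_all
    ultimately show "mul K i j \<psi>' \<phi> = mul K i j \<psi>'' \<phi>"
      by (simp only: K.ori_eq_iff)
  qed
  ultimately show ?thesis
    by metis
qed

lemma beta_spec:
  assumes "i + j = 4" and "\<theta> \<in> gr M i"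
  shows "\<beta> i \<theta> \<in> gr K i"
    and "\<phi> \<in> gr K j \<Longrightarrow> oK (mul K i j (\<beta> i \<theta>) \<phi>) = oM (mul M i j \<theta> (\<alpha> j \<phi>))"
proof -
  have "4 - i = j"
    using assms(1) by simp
  then have "\<beta> i \<theta> \<in> gr K i \<and>
      (\<forall>\<phi>\<in>gr K j. oK (mul K i j (\<beta> i \<theta>) \<phi>) = oM (mul M i j \<theta> (\<alpha> j \<phi>)))"
    unfolding dual_map_def using theI'[OF beta_ex1[OF assms]] by simp
  then show "\<beta> i \<theta> \<in> gr K i"
    and "\<phi> \<in> gr K j \<Longrightarrow> oK (mul K i j (\<beta> i \<theta>) \<phi>) = oM (mul M i j \<theta> (\<alpha> j \<phi>))"
    by auto
qed

lemma beta_in [simp]: "\<theta> \<in> gr M i \<Longrightarrow> i \<le> 4 \<Longrightarrow> \<beta> i \<theta> \<in> gr K i"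
  using beta_spec(1)[of i "4 - i"] by simp

lemma beta_eqI:
  assumes "i + j = 4" and "\<theta> \<in> gr M i" and "\<psi> \<in> gr K i"
    and "\<And>\<phi>. \<phi> \<in> gr K j \<Longrightarrow> oK (mul K i j \<psi> \<phi>) = oM (mul M i j \<theta> (\<alpha> j \<phi>))"
  shows "\<beta> i \<theta> = \<psi>"
  using beta_ex1[OF assms(1,2)] beta_spec[OF assms(1,2)] assms(3,4) by blast

lemma beta_lin:
  assumes "i \<le> 4"
  shows "lin_map (smul M) (gr M i) (smul K) (gr K i) (\<beta> i)"
proof -
  have ij: "i + (4 - i) = 4"
    using assms by simp
  show ?thesis
  proof (rule lin_mapI)
    show "\<beta> i x \<in> gr K i" if "x \<in> gr M i" for x
      using that assms by simp
  next
    fix x y assume xy: "x \<in> gr M i" "y \<in> gr M i"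
    show "\<beta> i (x + y) = \<beta> i x + \<beta> i y"
      by (rule beta_eqI[OF ij]) (use xy assms in \<open>simp_all add: beta_spec(2)[OF ij]
          lin_map_add[OF M.ori_lin] lin_map_add[OF K.ori_lin]\<close>)
  next
    fix c x assume x: "x \<in> gr M i"
    show "\<beta> i (smul M c x) = smul K c (\<beta> i x)"
      by (rule beta_eqI[OF ij]) (use x assms in \<open>simp_all add: beta_spec(2)[OF ij]
          K.ori_scale M.ori_scale\<close>)
  qed
qed

sublocale MK: module_pair "smul M" "smul K" ..

lemma beta_linear [simp]:
  assumes "i \<le> 4"
  shows beta_zero: "\<beta> i 0 = 0"
    and beta_add: "x \<in> gr M i \<Longrightarrow> y \<in> gr M i \<Longrightarrow> \<beta> i (x + y) = \<beta> i x + \<beta> i y"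
    and beta_diff: "x \<in> gr M i \<Longrightarrow> y \<in> gr M i \<Longrightarrow> \<beta> i (x - y) = \<beta> i x - \<beta> i y"
    and beta_neg: "x \<in> gr M i \<Longrightarrow> \<beta> i (- x) = - \<beta> i x"
    and beta_scale: "x \<in> gr M i \<Longrightarrow> \<beta> i (smul M c x) = smul K c (\<beta> i x)"
  by (rule MK.lin_map_zero[OF beta_lin M.gr_subspace] lin_map_add[OF beta_lin]
      MK.lin_map_diff[OF beta_lin M.gr_subspace]
      MK.lin_map_neg[OF beta_lin] lin_map_scale[OF beta_lin]; (rule assms | assumption))+

text \<open>
  The map \<open>\<beta>\<close> is the transpose of \<open>\<alpha>\<close>, so its properties are those of \<open>\<alpha>\<close>, transposed. It
  commutes with the differentials without a sign because the same sign occurs in both algebras when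
  the differential moves to the other factor.
\<close>

lemma beta_bd:
  assumes \<theta>: "\<theta> \<in> gr M i" and i: "i = Suc j" and "i \<le> 4"
  shows "\<beta> j (bd M i \<theta>) = bd K i (\<beta> i \<theta>)"
proof (rule beta_eqI)
  show "j + (4 - j) = 4"
    using assms by simp
  fix \<phi> assume \<phi>: "\<phi> \<in> gr K (4 - j)"
  let ?k = "4 - j"
  have k: "0 < ?k" "i + (?k - 1) = 4" "i - 1 = j" and above: "4 < i + ?k" and "?k = Suc (?k - 1)"
    using assms by simp_all
  have b\<phi>: "bd K ?k \<phi> \<in> gr K (?k - 1)"
    using \<phi> \<open>?k = Suc (?k - 1)\<close> by (rule K.bd_in)
  have b\<theta>: "\<beta> i \<theta> \<in> gr K i"
    using assms by simp
  have "oK (mul K j ?k (bd K i (\<beta> i \<theta>)) \<phi>) =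
      oK (smul K ((-1) ^ j) (mul K i (?k - 1) (\<beta> i \<theta>) (bd K ?k \<phi>)))"
    using K.bd_adjoint[OF K.gr_above[OF above] b\<theta> \<phi>] k i by simp
  also have "\<dots> = (-1) ^ j * oK (mul K i (?k - 1) (\<beta> i \<theta>) (bd K ?k \<phi>))"
    by (rule K.ori_scale, rule K.mul_in[OF b\<theta> b\<phi>]) (use k in simp)
  also have "\<dots> = (-1) ^ j * oM (mul M i (?k - 1) \<theta> (\<alpha> (?k - 1) (bd K ?k \<phi>)))"
    using beta_spec(2)[OF k(2) \<theta> b\<phi>] by simp
  also have "\<dots> = oM (smul M ((-1) ^ j) (mul M i (?k - 1) \<theta> (\<alpha> (?k - 1) (bd K ?k \<phi>))))"
    by (rule M.ori_scale[symmetric], rule M.mul_in[OF \<theta> alpha_in[OF b\<phi>]]) (use k in simp)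
  also have "\<dots> = oM (mul M j ?k (bd M i \<theta>) (\<alpha> ?k \<phi>))"
    using M.bd_adjoint[OF M.gr_above[OF above] \<theta> alpha_in[OF \<phi>]] k i
      alpha_bd[OF \<phi> \<open>?k = Suc (?k - 1)\<close>] by simp
  finally show "oK (mul K j ?k (bd K i (\<beta> i \<theta>)) \<phi>) = oM (mul M j ?k (bd M i \<theta>) (\<alpha> ?k \<phi>))" .
qed (use assms in auto)

text \<open>
  Since \<open>\<alpha>\<close> makes \<open>M\<close> a module over \<open>K\<close>, the transpose \<open>\<beta>\<close> is \<open>K\<close>-linear.  Applied to the unit this
  shows that \<open>\<beta> \<circ> \<alpha>\<close> is multiplication by \<open>\<beta>\<^sub>0(1)\<close>.  In degree four \<open>\<beta>\<close> is injective, so that the same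
  follows for \<open>\<alpha> \<circ> \<beta>\<close>.
\<close>

lemma beta_mul:
  assumes "\<theta> \<in> gr M i" and "\<phi> \<in> gr K j" and "n = i + j" and "n \<le> 4"
  shows "\<beta> n (mul M i j \<theta> (\<alpha> j \<phi>)) = mul K i j (\<beta> i \<theta>) \<phi>"
proof (rule beta_eqI)
  show n: "n + (4 - n) = 4"
    using assms by simp
  fix \<psi> assume \<psi>: "\<psi> \<in> gr K (4 - n)"
  have ijk: "i + (j + (4 - n)) = 4" and i: "i \<le> 4"
    using assms by simp_all
  have "mul K n (4 - n) (mul K i j (\<beta> i \<theta>) \<phi>) \<psi> =
      mul K i (j + (4 - n)) (\<beta> i \<theta>) (mul K j (4 - n) \<phi> \<psi>)"
    using assms \<psi> by (intro K.mul_assoc') auto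
  moreover have "mul M n (4 - n) (mul M i j \<theta> (\<alpha> j \<phi>)) (\<alpha> (4 - n) \<psi>) =
      mul M i (j + (4 - n)) \<theta> (\<alpha> (j + (4 - n)) (mul K j (4 - n) \<phi> \<psi>))"
    unfolding alpha_mul'[OF assms(2) \<psi>] using assms \<psi> by (intro M.mul_assoc') auto
  ultimately show "oK (mul K n (4 - n) (mul K i j (\<beta> i \<theta>) \<phi>) \<psi>) =
      oM (mul M n (4 - n) (mul M i j \<theta> (\<alpha> j \<phi>)) (\<alpha> (4 - n) \<psi>))"
    using beta_spec(2)[OF ijk assms(1), of "mul K j (4 - n) \<phi> \<psi>"] assms(2) \<psi> by simp
qed (use assms in auto)

lemma beta_rmul:
  assumes "\<theta> \<in> gr M i" and "\<sigma> \<in> gr K 1" and "j = Suc i" and "j \<le> 4"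
  shows "\<beta> j (rmul M (\<alpha> 1 \<sigma>) i \<theta>) = rmul K \<sigma> i (\<beta> i \<theta>)"
  using beta_mul[OF assms(1,2)] assms(3,4) by (simp add: rmul_def)

abbreviation b0 :: 'p where
  "b0 \<equiv> scalar K (\<beta> 0 (un M))"

lemma beta_alpha: "\<phi> \<in> gr K i \<Longrightarrow> i \<le> 4 \<Longrightarrow> \<beta> i (\<alpha> i \<phi>) = smul K b0 \<phi>"
  using beta_mul[of "un M" 0 \<phi> i i] by (simp add: M.mul_un_left K.scalar_mul)

lemma ori_beta4: "\<theta> \<in> gr M 4 \<Longrightarrow> oK (\<beta> 4 \<theta>) = oM \<theta>"
  using beta_spec(2)[of 4 0 \<theta> "un K"] by (simp add: alpha_un K.mul_un_right M.mul_un_right)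

lemma beta4_inj: "\<theta> \<in> gr M 4 \<Longrightarrow> \<theta>' \<in> gr M 4 \<Longrightarrow> \<beta> 4 \<theta> = \<beta> 4 \<theta>' \<Longrightarrow> \<theta> = \<theta>'"
  by (metis M.ori_eq_iff ori_beta4)

lemma alpha_beta4: "\<theta> \<in> gr M 4 \<Longrightarrow> \<alpha> 4 (\<beta> 4 \<theta>) = smul M b0 \<theta>"
  by (rule beta4_inj) (simp_all add: beta_alpha)

text \<open>
  Both sides are \<open>\<beta>(\<theta>) \<and> \<beta>(\<theta>')\<close> in the orientation of \<open>K\<close>.  For the left one the factors have to be
  exchanged in \<open>M\<close> and exchanged back in \<open>K\<close>, so the signs cancel.
\<close>

lemma alpha_beta_adjoint:
  assumes "i + j = 4" and "\<theta> \<in> gr M i" and "\<theta>' \<in> gr M j"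
  shows "mul M i j (\<alpha> i (\<beta> i \<theta>)) \<theta>' = mul M i j \<theta> (\<alpha> j (\<beta> j \<theta>'))"
proof -
  have ji: "j + i = 4" and le: "i \<le> 4" "j \<le> 4"
    using assms(1) by simp_all
  have in': "\<beta> i \<theta> \<in> gr K i" "\<beta> j \<theta>' \<in> gr K j"
    using assms le by simp_all
  have "mul M i j (\<alpha> i (\<beta> i \<theta>)) \<theta>' = smul M ((-1) ^ (i * j)) (mul M j i \<theta>' (\<alpha> i (\<beta> i \<theta>)))"
    by (rule M.graded_comm[OF alpha_in[OF in'(1)] assms(3)])
  then have "oM (mul M i j (\<alpha> i (\<beta> i \<theta>)) \<theta>') =
      (-1) ^ (i * j) * oM (mul M j i \<theta>' (\<alpha> i (\<beta> i \<theta>)))"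
    using assms in' ji by (simp add: M.ori_scale)
  also have "\<dots> = (-1) ^ (i * j) * oK (mul K j i (\<beta> j \<theta>') (\<beta> i \<theta>))"
    using beta_spec(2)[OF ji assms(3) in'(1)] by simp
  also have "\<dots> = oK (smul K ((-1) ^ (i * j)) (mul K j i (\<beta> j \<theta>') (\<beta> i \<theta>)))"
    using in' ji by (simp add: K.ori_scale)
  also have "\<dots> = oK (mul K i j (\<beta> i \<theta>) (\<beta> j \<theta>'))"
    using K.graded_comm[OF in'] by simp
  also have "\<dots> = oM (mul M i j \<theta> (\<alpha> j (\<beta> j \<theta>')))"
    by (rule beta_spec(2)[OF assms(1,2) in'(2)])
  finally show ?thesis
    using assms in' by (simp add: M.ori_eq_iff)
qed

end

text \<open>
  From here on the degrees are numerals; keeping \<open>1\<close> in numeral form lets the rules for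
  multiplication and differential match in degree one.
\<close>

declare One_nat_def [simp del] One_nat_def [symmetric, simp]

context dg_algebra
begin

lemma rmul_linear [simp]:
  assumes "\<tau> \<in> gr F 1"
  shows rmul_in: "x \<in> gr F i \<Longrightarrow> n = Suc i \<Longrightarrow> rmul F \<tau> i x \<in> gr F n"
    and rmul_zero: "rmul F \<tau> i 0 = 0"
    and rmul_add: "x \<in> gr F i \<Longrightarrow> y \<in> gr F i \<Longrightarrow> rmul F \<tau> i (x + y) = rmul F \<tau> i x + rmul F \<tau> i y"
    and rmul_diff: "x \<in> gr F i \<Longrightarrow> y \<in> gr F i \<Longrightarrow> rmul F \<tau> i (x - y) = rmul F \<tau> i x - rmul F \<tau> i y"
    and rmul_neg: "x \<in> gr F i \<Longrightarrow> rmul F \<tau> i (- x) = - rmul F \<tau> i x"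
    and rmul_scale: "x \<in> gr F i \<Longrightarrow> rmul F \<tau> i (smul F c x) = smul F c (rmul F \<tau> i x)"
  using assms by (simp_all add: rmul_def)

end

context oriented_dg_algebra
begin

lemma rmul_bd_top:
  assumes "\<theta> \<in> gr F n" and "\<tau> \<in> gr F 1" and "0 < n"
  shows "rmul F \<tau> (n - 1) (bd F n \<theta>) = - smul F ((-1) ^ n * scalar F (bd F 1 \<tau>)) \<theta>"
proof -
  have "rmul F \<tau> n \<theta> \<in> gr F (Suc n)"
    using assms(1,2) by simp
  then have "rmul F \<tau> n \<theta> = 0"
    by (simp only: gr_above lessI singleton_iff)
  then show ?thesis
    using bd_rmul[OF assms] by (simp add: eq_neg_iff_add_eq_0)
qed

end

section \<open>The map X and its adjoint\<close>

text \<open>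
  The data of the theorem, with the conditions on \<open>X\<close> named after the composites that they evaluate.
  The regular sequence enters as one regular element of the ideal that \<open>K\<close> resolves, and \<open>I\<close> is the
  ideal that \<open>M\<close> resolves.
\<close>

locale linkage_data = dual_pair K oK M oM \<alpha>
  for K :: "('p::comm_ring_1, 'k::ab_group_add, 'y) dg_scheme" and oK
    and M :: "('p, 'm::ab_group_add, 'z) dg_scheme" and oM and \<alpha> +
  fixes M11 M12 :: "'m set" and I :: "'p set" and f r :: 'p and \<sigma> :: 'k and X :: "'m \<Rightarrow> 'm"
  assumes resolution: "resolution_of M I"
    and sum: "direct_sum (smul M) (gr M 1) M11 M12"
    and iota: "lin_iso (smul K) (gr K 1) (smul M) M11 (proj M11 M12 \<circ> \<alpha> 1)"
    and proj_alpha: "\<phi> \<in> gr K 1 \<Longrightarrow> proj M12 M11 (\<alpha> 1 \<phi>) = 0"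
    and regular: "\<exists>\<phi>\<in>gr K 1. regular_element (scalar K (bd K 1 \<phi>))"
    and sigma_in [simp]: "\<sigma> \<in> gr K 1"
    and f_eq: "f = r * b0 + scalar K (bd K 1 \<sigma>)"
    and X_lin: "lin_map (smul M) (gr M 1) (smul M) (gr M 2) X"
    and X_alpha: "\<phi> \<in> gr K 1 \<Longrightarrow> X (\<alpha> 1 \<phi>) = 0"
    and bd_X: "\<theta> \<in> gr M 1 \<Longrightarrow> bd M 2 (X \<theta>) = smul M b0 \<theta> - \<alpha> 1 (\<beta> 1 \<theta>)"
    and X_bd: "\<theta> \<in> gr M 2 \<Longrightarrow>
          X (bd M 2 \<theta>) + bd M 3 (adjoint_map M X \<theta>) = smul M b0 \<theta> - \<alpha> 2 (\<beta> 2 \<theta>)"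
    and adj_X: "\<theta> \<in> gr M 1 \<Longrightarrow> adjoint_map M X (X \<theta>) = 0"
    and adj_alpha: "\<phi> \<in> gr K 2 \<Longrightarrow> adjoint_map M X (\<alpha> 2 \<phi>) = 0"
begin

abbreviation a :: 'm where "a \<equiv> \<alpha> 1 \<sigma>"
abbreviation k :: 'p where "k \<equiv> scalar K (bd K 1 \<sigma>)"
abbreviation X' :: "'m \<Rightarrow> 'm" where "X' \<equiv> adjoint_map M X"

lemma a_in [simp]: "a \<in> gr M 1"
  by (rule alpha_in[OF sigma_in])

lemma exact3:
  assumes "\<theta> \<in> gr M 3" and "bd M 3 \<theta> = 0"
  shows "\<exists>u\<in>gr M 4. \<theta> = bd M 4 u"
proof -
  have "\<forall>i\<ge>1. {x \<in> gr M i. bd M i x = 0} = bd M (Suc i) ` gr M (Suc i)"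
    using resolution unfolding resolution_of_def by (rule conjunct2)
  then have "{x \<in> gr M 3. bd M 3 x = 0} = bd M (Suc 3) ` gr M (Suc 3)"
    by (rule allE[of _ 3]) simp
  moreover have "\<theta> \<in> {x \<in> gr M 3. bd M 3 x = 0}"
    using assms by simp
  ultimately have "\<theta> \<in> bd M (Suc 3) ` gr M (Suc 3)"
    by (rule subst)
  then show ?thesis
    by auto
qed

lemma scalar_bd_alpha: "\<phi> \<in> gr K 1 \<Longrightarrow> scalar M (bd M 1 (\<alpha> 1 \<phi>)) = scalar K (bd K 1 \<phi>)"
proof -
  assume \<phi>: "\<phi> \<in> gr K 1"
  then have "bd K 1 \<phi> \<in> gr K 0"
    by simp
  then have "bd K 1 \<phi> = smul K (scalar K (bd K 1 \<phi>)) (un K)"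
    by (simp add: K.smul_scalar)
  then have "bd M 1 (\<alpha> 1 \<phi>) = \<alpha> 0 (smul K (scalar K (bd K 1 \<phi>)) (un K))"
    using alpha_bd[OF \<phi>, of 0] by simp
  also have "\<dots> = smul M (scalar K (bd K 1 \<phi>)) (un M)"
    by (simp add: alpha_un)
  finally show ?thesis
    by simp
qed

lemma X_linear [simp]:
  shows X_in: "x \<in> gr M 1 \<Longrightarrow> X x \<in> gr M 2"
    and X_zero: "X 0 = 0"
    and X_add: "x \<in> gr M 1 \<Longrightarrow> y \<in> gr M 1 \<Longrightarrow> X (x + y) = X x + X y"
    and X_diff: "x \<in> gr M 1 \<Longrightarrow> y \<in> gr M 1 \<Longrightarrow> X (x - y) = X x - X y"
    and X_neg: "x \<in> gr M 1 \<Longrightarrow> X (- x) = - X x"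
    and X_scale: "x \<in> gr M 1 \<Longrightarrow> X (smul M c x) = smul M c (X x)"
  by (rule lin_map_in[OF X_lin] M.scale_pair.lin_map_zero[OF X_lin M.gr_subspace]
      lin_map_add[OF X_lin] M.scale_pair.lin_map_diff[OF X_lin M.gr_subspace]
      M.scale_pair.lin_map_neg[OF X_lin] lin_map_scale[OF X_lin]; assumption)+

lemma adj_ex1:
  assumes "\<theta> \<in> gr M 2"
  shows "\<exists>!\<theta>3. \<theta>3 \<in> gr M 3 \<and> (\<forall>\<theta>1\<in>gr M 1. mul M 3 1 \<theta>3 \<theta>1 = mul M 2 2 \<theta> (X \<theta>1))"
proof -
  have "lin_map (smul M) (gr M 1) (smul M) (gr M 4) (\<lambda>\<theta>1. mul M 2 2 \<theta> (X \<theta>1))"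
    by (rule lin_mapI) (use assms in simp_all)
  then show ?thesis
    using M.perfect[of 3 1] by (simp add: perfect_pairing_def)
qed

lemma adj:
  assumes "\<theta> \<in> gr M 2"
  shows adj_in [simp]: "X' \<theta> \<in> gr M 3"
    and adj_mul: "\<theta>1 \<in> gr M 1 \<Longrightarrow> mul M 3 1 (X' \<theta>) \<theta>1 = mul M 2 2 \<theta> (X \<theta>1)"
  using theI'[OF adj_ex1[OF assms]] by (simp_all add: adjoint_map_def)

lemma eq3I:
  assumes "x \<in> gr M 3" "y \<in> gr M 3" and "\<And>\<theta>. \<theta> \<in> gr M 1 \<Longrightarrow> mul M 3 1 x \<theta> = mul M 3 1 y \<theta>"
  shows "x = y"
  using M.pairing_eqI[of 3 1 x y] assms by simp

lemma adj_lin: "lin_map (smul M) (gr M 2) (smul M) (gr M 3) X'"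
proof (rule lin_mapI)
  show "X' (x + y) = X' x + X' y" if "x \<in> gr M 2" "y \<in> gr M 2" for x y
    by (rule eq3I) (use that in \<open>simp_all add: adj_mul\<close>)
  show "X' (smul M c x) = smul M c (X' x)" if "x \<in> gr M 2" for c x
    by (rule eq3I) (use that in \<open>simp_all add: adj_mul\<close>)
qed simp

lemma adj_linear [simp]:
  shows adj_zero: "X' 0 = 0"
    and adj_add: "x \<in> gr M 2 \<Longrightarrow> y \<in> gr M 2 \<Longrightarrow> X' (x + y) = X' x + X' y"
    and adj_diff: "x \<in> gr M 2 \<Longrightarrow> y \<in> gr M 2 \<Longrightarrow> X' (x - y) = X' x - X' y"
    and adj_neg: "x \<in> gr M 2 \<Longrightarrow> X' (- x) = - X' x"
    and adj_scale: "x \<in> gr M 2 \<Longrightarrow> X' (smul M c x) = smul M c (X' x)"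
  by (rule M.scale_pair.lin_map_zero[OF adj_lin M.gr_subspace]
      lin_map_add[OF adj_lin] M.scale_pair.lin_map_diff[OF adj_lin M.gr_subspace]
      M.scale_pair.lin_map_neg[OF adj_lin] lin_map_scale[OF adj_lin]; assumption)+

text \<open>Multiplication by \<open>\<sigma>\<close>, and by its image in \<open>M\<close>, as null-homotopies of \<open>k\<close>.\<close>

lemma bd_w1:
  assumes "\<theta> \<in> gr M 1"
  shows "bd M 2 (rmul M a 1 \<theta>) = smul M (scalar M (bd M 1 \<theta>)) a - smul M k \<theta>"
proof -
  have "rmul M a 0 (bd M 1 \<theta>) = smul M (scalar M (bd M 1 \<theta>)) a"
    unfolding rmul_def by (rule M.scalar_mul) (use assms in simp_all)
  then show ?thesis
    using M.bd_rmul[OF assms a_in] by (simp add: scalar_bd_alpha)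
qed

lemma bd_w2:
  "\<theta> \<in> gr M 2 \<Longrightarrow> bd M 3 (rmul M a 2 \<theta>) = rmul M a 1 (bd M 2 \<theta>) + smul M k \<theta>"
  using M.bd_rmul[of \<theta> 2 a] by (simp add: scalar_bd_alpha)

lemma bd_w3:
  "\<theta> \<in> gr M 3 \<Longrightarrow> bd M 4 (rmul M a 3 \<theta>) = rmul M a 2 (bd M 3 \<theta>) - smul M k \<theta>"
  using M.bd_rmul[of \<theta> 3 a] by (simp add: scalar_bd_alpha)

lemma w3_bd: "\<theta> \<in> gr M 4 \<Longrightarrow> rmul M a 3 (bd M 4 \<theta>) = - smul M k \<theta>"
  using M.rmul_bd_top[of \<theta> a] by (simp add: scalar_bd_alpha)

lemma bd_z2:
  "\<phi> \<in> gr K 2 \<Longrightarrow> bd K 3 (rmul K \<sigma> 2 \<phi>) = rmul K \<sigma> 1 (bd K 2 \<phi>) + smul K k \<phi>"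
  using K.bd_rmul[of \<phi> 2 \<sigma>] by simp

lemma bd_z3:
  "\<phi> \<in> gr K 3 \<Longrightarrow> bd K 4 (rmul K \<sigma> 3 \<phi>) = rmul K \<sigma> 2 (bd K 3 \<phi>) - smul K k \<phi>"
  using K.bd_rmul[of \<phi> 3 \<sigma>] by simp

lemma z3_bd: "\<phi> \<in> gr K 4 \<Longrightarrow> rmul K \<sigma> 3 (bd K 4 \<phi>) = - smul K k \<phi>"
  using K.rmul_bd_top[of \<phi> \<sigma>] by simp

lemma w_w: "\<theta> \<in> gr M i \<Longrightarrow> j = Suc i \<Longrightarrow> rmul M a j (rmul M a i \<theta>) = 0"
  by (rule M.rmul_rmul) simp_all

lemma z_z: "\<phi> \<in> gr K i \<Longrightarrow> j = Suc i \<Longrightarrow> rmul K \<sigma> j (rmul K \<sigma> i \<phi>) = 0"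
  by (rule K.rmul_rmul) simp_all

lemma w_alpha: "\<phi> \<in> gr K i \<Longrightarrow> j = Suc i \<Longrightarrow> rmul M a i (\<alpha> i \<phi>) = \<alpha> j (rmul K \<sigma> i \<phi>)"
  unfolding rmul_def by (rule alpha_mul) simp_all

lemma beta_w: "\<theta> \<in> gr M i \<Longrightarrow> j = Suc i \<Longrightarrow> j \<le> 4 \<Longrightarrow> \<beta> j (rmul M a i \<theta>) = rmul K \<sigma> i (\<beta> i \<theta>)"
  by (rule beta_rmul) simp_all

text \<open>
  Conditions (a), (b) and (e) each have a transposed form: \<open>X\<^sup>\<dagger> \<circ> m\<^sub>3 = \<beta>\<^sub>0(1) - \<alpha>\<^sub>3 \<circ> \<beta>\<^sub>3\<close> from (b),
  \<open>\<beta>\<^sub>2 \<circ> X = 0\<close> from (e), and \<open>\<beta>\<^sub>3 \<circ> X\<^sup>\<dagger> = 0\<close> from (a).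
\<close>

lemma adj_bd:
  assumes "\<theta> \<in> gr M 3"
  shows "X' (bd M 3 \<theta>) = smul M b0 \<theta> - \<alpha> 3 (\<beta> 3 \<theta>)"
proof (rule eq3I)
  fix \<theta>1 assume \<theta>1: "\<theta>1 \<in> gr M 1"
  have "mul M 3 1 (X' (bd M 3 \<theta>)) \<theta>1 = mul M 2 2 (bd M 3 \<theta>) (X \<theta>1)"
    using assms \<theta>1 by (intro adj_mul) simp_all
  also have "\<dots> = mul M 3 1 \<theta> (bd M 2 (X \<theta>1))"
    using M.bd_adjoint[of 3 2 \<theta> "X \<theta>1"] M.gr_above[of "3 + 2"] assms \<theta>1 by simp
  also have "\<dots> = mul M 3 1 (smul M b0 \<theta> - \<alpha> 3 (\<beta> 3 \<theta>)) \<theta>1"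
    using assms \<theta>1 alpha_beta_adjoint[of 3 1 \<theta> \<theta>1] by (simp add: bd_X)
  finally show "mul M 3 1 (X' (bd M 3 \<theta>)) \<theta>1 = mul M 3 1 (smul M b0 \<theta> - \<alpha> 3 (\<beta> 3 \<theta>)) \<theta>1" .
qed (use assms in simp_all)

lemma mul_alpha_X:
  assumes "\<phi> \<in> gr K 2" and "\<theta> \<in> gr M 1"
  shows "mul M 2 2 (X \<theta>) (\<alpha> 2 \<phi>) = 0"
proof -
  have "mul M 2 2 (X \<theta>) (\<alpha> 2 \<phi>) = mul M 2 2 (\<alpha> 2 \<phi>) (X \<theta>)"
    using assms M.graded_comm[of "X \<theta>" 2 "\<alpha> 2 \<phi>" 2] by simp
  also have "\<dots> = mul M 3 1 (X' (\<alpha> 2 \<phi>)) \<theta>"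
    using assms by (simp add: adj_mul)
  finally show ?thesis
    using assms by (simp add: adj_alpha)
qed

lemma ori_zero: "oM 0 = 0" "oK 0 = 0"
  using M.ori_scale[of 0 0] K.ori_scale[of 0 0] by simp_all

lemma beta_X: "\<theta> \<in> gr M 1 \<Longrightarrow> \<beta> 2 (X \<theta>) = 0"
  by (rule beta_eqI[of 2 2]) (simp_all add: mul_alpha_X ori_zero)

lemma mul_adj_alpha: "\<theta> \<in> gr M 2 \<Longrightarrow> \<phi> \<in> gr K 1 \<Longrightarrow> mul M 3 1 (X' \<theta>) (\<alpha> 1 \<phi>) = 0"
  by (simp add: adj_mul X_alpha)

lemma beta_adj: "\<theta> \<in> gr M 2 \<Longrightarrow> \<beta> 3 (X' \<theta>) = 0"
  by (rule beta_eqI[of 3 1]) (use mul_adj_alpha in \<open>simp_all add: ori_zero\<close>)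

lemma w3_adj: "\<theta> \<in> gr M 2 \<Longrightarrow> rmul M a 3 (X' \<theta>) = 0"
  using mul_adj_alpha[of \<theta> \<sigma>] by (simp add: rmul_def)

text \<open>
  This commutation is the one relation that is not formal.  By (a), (b) and (c) both sides have the
  same differential, so by exactness they differ by the differential of some \<open>u\<close> of degree four.
  By (a) and (e) the image of \<open>\<alpha>\<^sub>1\<close> annihilates both sides, so that the ideal resolved by \<open>K\<close>
  annihilates \<open>u\<close>; it contains a regular element, whence \<open>u = 0\<close>.  It would not be enough to check the
  relation after multiplication by \<open>\<beta>\<^sub>0(1)\<close>, which is not assumed to be regular.
\<close>

lemma adj_w1:
  assumes \<theta>: "\<theta> \<in> gr M 1"
  shows "X' (rmul M a 1 \<theta>) = rmul M a 2 (X \<theta>)"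
proof -
  let ?d = "X' (rmul M a 1 \<theta>) - rmul M a 2 (X \<theta>)"
  have d: "?d \<in> gr M 3"
    using \<theta> by simp
  have w1: "rmul M a 1 \<theta> \<in> gr M 2"
    using \<theta> by simp
  have "X (bd M 2 (rmul M a 1 \<theta>)) = - smul M k (X \<theta>)"
    using \<theta> by (simp add: bd_w1 X_alpha)
  moreover have "\<alpha> 2 (\<beta> 2 (rmul M a 1 \<theta>)) = rmul M a 1 (\<alpha> 1 (\<beta> 1 \<theta>))"
    using \<theta> by (simp add: beta_w w_alpha)
  ultimately have "bd M 3 (X' (rmul M a 1 \<theta>)) =
      smul M b0 (rmul M a 1 \<theta>) - rmul M a 1 (\<alpha> 1 (\<beta> 1 \<theta>)) + smul M k (X \<theta>)"
    using X_bd[OF w1] by (simp add: algebra_simps)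
  also have "\<dots> = bd M 3 (rmul M a 2 (X \<theta>))"
    using \<theta> by (simp add: bd_w2 bd_X)
  finally have "bd M 3 ?d = 0"
    using \<theta> by simp
  then obtain u where u: "u \<in> gr M 4" "?d = bd M 4 u"
    using exact3[OF d] by blast
  obtain \<phi> where \<phi>: "\<phi> \<in> gr K 1" and reg: "regular_element (scalar K (bd K 1 \<phi>))"
    using regular by blast
  have "mul M 3 1 ?d (\<alpha> 1 \<phi>) = - mul M 3 1 (rmul M a 2 (X \<theta>)) (\<alpha> 1 \<phi>)"
    using \<theta> \<phi> mul_adj_alpha[OF w1 \<phi>] by simp
  also have "mul M 3 1 (rmul M a 2 (X \<theta>)) (\<alpha> 1 \<phi>) = mul M 2 2 (X \<theta>) (mul M 1 1 a (\<alpha> 1 \<phi>))"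
    unfolding rmul_def by (rule M.mul_assoc') (use \<theta> \<phi> in simp_all)
  also have "mul M 1 1 a (\<alpha> 1 \<phi>) = \<alpha> 2 (mul K 1 1 \<sigma> \<phi>)"
    by (rule alpha_mul) (use \<phi> in simp_all)
  also have "mul M 2 2 (X \<theta>) (\<alpha> 2 (mul K 1 1 \<sigma> \<phi>)) = 0"
    by (rule mul_alpha_X) (use \<theta> \<phi> in simp_all)
  finally have "mul M 3 1 (bd M 4 u) (\<alpha> 1 \<phi>) = 0"
    by (simp add: u(2))
  moreover have "mul M 3 1 (bd M 4 u) (\<alpha> 1 \<phi>) = - smul M (scalar K (bd K 1 \<phi>)) u"
    using M.bd_adjoint[of 4 1 u "\<alpha> 1 \<phi>"] M.gr_above[of "4 + 1"] u(1) \<phi> scalar_bd_alpha[OF \<phi>]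
    by (simp add: M.mul_scalar)
  ultimately have "oM (smul M (scalar K (bd K 1 \<phi>)) u) = 0"
    by (simp add: ori_zero)
  then have "scalar K (bd K 1 \<phi>) * oM u = 0"
    using u(1) by (simp add: M.ori_scale)
  then have "oM u = oM 0"
    using reg by (simp add: regular_element_def ori_zero)
  then have "u = 0"
    using u(1) by (simp only: M.ori_eq_iff M.gr_zero)
  then show ?thesis
    using u(2) by simp
qed

end

section \<open>The matrix factorizations\<close>

context linkage_data
begin

abbreviation p1 :: "'m \<Rightarrow> 'm" where "p1 \<equiv> proj M11 M12"
abbreviation p2 :: "'m \<Rightarrow> 'm" where "p2 \<equiv> proj M12 M11"
abbreviation \<iota>' :: "'m \<Rightarrow> 'k" where "\<iota>' \<equiv> inv_into (gr K 1) (p1 \<circ> \<alpha> 1)"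
abbreviation Y :: "'m \<Rightarrow> 'k" where "Y \<equiv> Y_map K M M11 M12 \<alpha> \<sigma>"

lemma sum': "direct_sum (smul M) (gr M 1) M12 M11"
  by (rule M.direct_sum_commute[OF sum])

lemma M1_subspaces: "M.subspace M11" "M.subspace M12"
  using sum by (simp_all add: direct_sum_def)

lemma M11_in [simp]: "x \<in> M11 \<Longrightarrow> x \<in> gr M 1"
  and M12_in [simp]: "x \<in> M12 \<Longrightarrow> x \<in> gr M 1"
proof -
  have eq: "gr M 1 = {b + c | b c. b \<in> M11 \<and> c \<in> M12}"
    using sum by (simp add: direct_sum_def)
  show "x \<in> gr M 1" if "x \<in> M11"
  proof -
    have "x + 0 \<in> {b + c | b c. b \<in> M11 \<and> c \<in> M12}"
      using that M.subspace_0[OF M1_subspaces(2)] by blast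
    then show ?thesis
      by (simp only: eq add_0_right)
  qed
  show "x \<in> gr M 1" if "x \<in> M12"
  proof -
    have "0 + x \<in> {b + c | b c. b \<in> M11 \<and> c \<in> M12}"
      using that M.subspace_0[OF M1_subspaces(1)] by blast
    then show ?thesis
      by (simp only: eq add_0_left)
  qed
qed

lemma p_in [simp]: "x \<in> gr M 1 \<Longrightarrow> p1 x \<in> M11" "x \<in> gr M 1 \<Longrightarrow> p2 x \<in> M12"
  by (rule lin_map_in[OF M.lin_map_proj[OF sum]] lin_map_in[OF M.lin_map_proj[OF sum']];
      assumption)+

lemma p_sum: "x \<in> gr M 1 \<Longrightarrow> p1 x + p2 x = x"
  by (rule M.proj_add_proj[OF sum])

lemma p1_alpha: "\<phi> \<in> gr K 1 \<Longrightarrow> p1 (\<alpha> 1 \<phi>) = \<alpha> 1 \<phi>"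
  using p_sum[of "\<alpha> 1 \<phi>"] by (simp add: proj_alpha)

lemma alpha1_in [simp]: "\<phi> \<in> gr K 1 \<Longrightarrow> \<alpha> 1 \<phi> \<in> M11"
  using p_in(1)[of "\<alpha> 1 \<phi>"] by (simp add: p1_alpha)

lemma iota'_lin: "lin_map (smul M) M11 (smul K) (gr K 1) \<iota>'"
  by (rule KM.lin_iso_inv_into[OF iota K.gr_subspace])

lemma iota'_in [simp]: "x \<in> M11 \<Longrightarrow> \<iota>' x \<in> gr K 1"
  by (rule lin_map_in[OF iota'_lin])

lemma alpha_iota':
  assumes "x \<in> M11"
  shows "\<alpha> 1 (\<iota>' x) = x"
proof -
  have "(p1 \<circ> \<alpha> 1) (\<iota>' x) = x"
    using iota assms by (intro f_inv_into_f) (auto simp: lin_iso_def bij_betw_def)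
  then show ?thesis
    using assms by (simp add: p1_alpha)
qed

lemma iota'_alpha:
  assumes "\<phi> \<in> gr K 1"
  shows "\<iota>' (\<alpha> 1 \<phi>) = \<phi>"
proof -
  have "\<iota>' ((p1 \<circ> \<alpha> 1) \<phi>) = \<phi>"
    using iota assms by (intro inv_into_f_f) (simp_all add: lin_iso_def bij_betw_def)
  then show ?thesis
    using assms by (simp add: p1_alpha)
qed

lemma X_p2:
  assumes "x \<in> gr M 1"
  shows "X (p2 x) = X x"
proof -
  have "X (p1 x) = 0"
    using X_alpha[of "\<iota>' (p1 x)"] assms by (simp add: alpha_iota')
  moreover have "X (p1 x + p2 x) = X (p1 x) + X (p2 x)"
    using assms by (intro X_add) simp_all
  ultimately show ?thesis
    using assms by (simp add: p_sum)
qed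

lemma sigma_sigma: "rmul K \<sigma> 1 \<sigma> = 0"
  unfolding rmul_def by (rule K.odd_square) simp_all

lemma Y_eq: "Y \<theta> = rmul K \<sigma> 1 (\<iota>' (p1 (bd M 2 \<theta>)))"
  by (simp add: Y_map_def)

lemma Y_in [simp]: "\<theta> \<in> gr M 2 \<Longrightarrow> Y \<theta> \<in> gr K 2"
  by (simp add: Y_eq)

lemma Y_add: "x \<in> gr M 2 \<Longrightarrow> y \<in> gr M 2 \<Longrightarrow> Y (x + y) = Y x + Y y"
  by (simp add: Y_eq lin_map_add[OF M.lin_map_proj[OF sum]] lin_map_add[OF iota'_lin])

lemma Y_scale: "x \<in> gr M 2 \<Longrightarrow> Y (smul M c x) = smul K c (Y x)"
  by (simp add: Y_eq lin_map_scale[OF M.lin_map_proj[OF sum]] lin_map_scale[OF iota'_lin])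

lemma alpha_Y: "\<theta> \<in> gr M 2 \<Longrightarrow> \<alpha> 2 (Y \<theta>) = rmul M a 1 (p1 (bd M 2 \<theta>))"
  unfolding Y_eq by (subst w_alpha[symmetric]) (simp_all add: alpha_iota')

lemma z_Y: "\<theta> \<in> gr M 2 \<Longrightarrow> rmul K \<sigma> 2 (Y \<theta>) = 0"
  unfolding Y_eq by (rule z_z) simp_all

text \<open>
  The form in which \<open>Y\<close> and the projection to \<open>M\<^sub>1\<^sub>,\<^sub>2\<close> are evaluated: it is enough to write the
  boundary as an element of \<open>M\<^sub>1\<^sub>,\<^sub>2\<close> plus an element of the image of \<open>\<alpha>\<^sub>1\<close>.
\<close>

lemma decompose_bd:
  assumes "bd M 2 \<theta> = x + \<alpha> 1 \<psi>" and "x \<in> M12" and "\<psi> \<in> gr K 1"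
  shows "p2 (bd M 2 \<theta>) = x" and "Y \<theta> = rmul K \<sigma> 1 \<psi>"
proof -
  have "p1 (\<alpha> 1 \<psi> + x) = \<alpha> 1 \<psi>"
    using assms by (intro M.proj_eqI[OF sum]) simp_all
  then show "Y \<theta> = rmul K \<sigma> 1 \<psi>"
    using assms by (simp add: Y_eq iota'_alpha add.commute)
  show "p2 (bd M 2 \<theta>) = x"
    unfolding assms(1) by (rule M.proj_eqI[OF sum']) (use assms in simp_all)
qed

abbreviation g_ev :: "'m \<times> 'k \<times> 'm \<times> 'k \<Rightarrow> 'm \<times> 'k \<times> 'm" where
  "g_ev \<equiv> g_even K M \<alpha> \<beta> r \<sigma> X"
abbreviation g_od :: "'m \<times> 'k \<times> 'm \<Rightarrow> 'm \<times> 'k \<times> 'm \<times> 'k" where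
  "g_od \<equiv> g_odd K M M11 M12 \<alpha> \<beta> r \<sigma> X"

text \<open>
  In each component the terms with \<open>X\<close>, \<open>\<alpha>\<close> and \<open>\<beta>\<close> add up to \<open>r b\<close> and the terms with \<open>w\<close>, \<open>z\<close> and the
  differentials to \<open>k\<close>.  In \<open>K\<^sub>2\<close> the term \<open>r z\<^sub>1(\<beta>\<^sub>1 \<theta>\<^sub>1)\<close> of \<open>Y\<close> cancels against \<open>r \<beta>\<^sub>2(w\<^sub>1 \<theta>\<^sub>1)\<close>; in \<open>M\<^sub>3\<close> the
  mixed terms \<open>r X\<^sup>\<dagger>(w\<^sub>1 \<theta>\<^sub>1)\<close> and \<open>r w\<^sub>2(X \<theta>\<^sub>1)\<close> cancel by \<open>adj_w1\<close>.
\<close>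

lemma g_odd_g_even:
  assumes "\<theta>1 \<in> M12" and "\<phi>2 \<in> gr K 2" and "\<theta>3 \<in> gr M 3" and "\<phi>4 \<in> gr K 4"
  shows "g_od (g_ev (\<theta>1, \<phi>2, \<theta>3, \<phi>4)) = (smul M f \<theta>1, smul K f \<phi>2, smul M f \<theta>3, smul K f \<phi>4)"
proof -
  define A where "A = smul M r (X \<theta>1) - rmul M a 1 \<theta>1 + \<alpha> 2 \<phi>2 + bd M 3 \<theta>3"
  define B where "B = - rmul K \<sigma> 2 \<phi>2 + smul K r (\<beta> 3 \<theta>3) - bd K 4 \<phi>4"
  define C where "C = - rmul M a 3 \<theta>3 + \<alpha> 4 \<phi>4"
  (* the component of the boundary of A in the image of alpha, where the contribution of the
     homotopy w is the multiple of sigma by the boundary of theta1 *)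
  define \<psi> where "\<psi> = bd K 2 \<phi>2 - smul K r (\<beta> 1 \<theta>1) - smul K (scalar M (bd M 1 \<theta>1)) \<sigma>"
  note [simp] = assms
  have [simp]: "A \<in> gr M 2" "B \<in> gr K 3" "C \<in> gr M 4" "\<psi> \<in> gr K 1"
    by (simp_all add: A_def B_def C_def \<psi>_def)
  have bdA: "bd M 2 A = smul M f \<theta>1 + \<alpha> 1 \<psi>"
    by (simp add: A_def \<psi>_def bd_X bd_w1 alpha_bd f_eq algebra_simps)
  have "smul M f \<theta>1 \<in> M12"
    by (rule M.subspace_scale[OF M1_subspaces(2)]) simp
  then have "p2 (bd M 2 A) = smul M f \<theta>1" and YA: "Y A = rmul K \<sigma> 1 \<psi>"
    using decompose_bd[OF bdA] by simp_all
  moreover have "smul K r (\<beta> 2 A) - Y A - bd K 3 B = smul K f \<phi>2"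
    unfolding YA
    by (simp add: A_def B_def \<psi>_def beta_X beta_w beta_alpha beta_bd bd_z2 f_eq
        algebra_simps sigma_sigma)
  moreover have "smul M r (X' A) + rmul M a 2 A + \<alpha> 3 B + bd M 4 C = smul M f \<theta>3"
    by (simp add: A_def B_def C_def adj_X adj_w1 adj_alpha adj_bd w_w w_alpha bd_w3 alpha_bd
        f_eq algebra_simps)
  moreover have "rmul K \<sigma> 3 B + smul K r (\<beta> 4 C) = smul K f \<phi>4"
    by (simp add: B_def C_def z_z z3_bd beta_w beta_alpha f_eq algebra_simps)
  moreover have "g_ev (\<theta>1, \<phi>2, \<theta>3, \<phi>4) = (A, B, C)"
    by (simp only: g_even_def A_def B_def C_def prod.case)
  ultimately show ?thesis
    by (simp only: g_odd_def prod.case)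
qed

text \<open>
  Here the component in \<open>M\<^sub>2\<close> is \<open>r\<close> times condition (c) plus the homotopy for \<open>k\<close>.  The map \<open>Y\<close> is made for this component:
  \<open>\<alpha>\<^sub>2 \<circ> Y\<close> supplies the part of \<open>w\<^sub>1 \<circ> m\<^sub>2\<close> that the projection to \<open>M\<^sub>1\<^sub>,\<^sub>2\<close> loses, while \<open>X\<close> is zero on
  \<open>M\<^sub>1\<^sub>,\<^sub>1\<close> and so loses nothing.
\<close>

lemma g_even_g_odd:
  assumes "\<theta>2 \<in> gr M 2" and "\<phi>3 \<in> gr K 3" and "\<theta>4 \<in> gr M 4"
  shows "g_ev (g_od (\<theta>2, \<phi>3, \<theta>4)) = (smul M f \<theta>2, smul K f \<phi>3, smul M f \<theta>4)"
proof -
  define A where "A = p2 (bd M 2 \<theta>2)"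
  define B where "B = smul K r (\<beta> 2 \<theta>2) - Y \<theta>2 - bd K 3 \<phi>3"
  define C where "C = smul M r (X' \<theta>2) + rmul M a 2 \<theta>2 + \<alpha> 3 \<phi>3 + bd M 4 \<theta>4"
  define D where "D = rmul K \<sigma> 3 \<phi>3 + smul K r (\<beta> 4 \<theta>4)"
  note [simp] = assms
  have [simp]: "A \<in> M12" "B \<in> gr K 2" "C \<in> gr M 3" "D \<in> gr K 4"
    by (simp_all add: A_def B_def C_def D_def)
  have XA: "X A = X (bd M 2 \<theta>2)"
    by (simp add: A_def X_p2)
  have wA: "rmul M a 1 A = rmul M a 1 (bd M 2 \<theta>2) - rmul M a 1 (p1 (bd M 2 \<theta>2))"
  proof -
    have "A = bd M 2 \<theta>2 - p1 (bd M 2 \<theta>2)"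
      using p_sum[of "bd M 2 \<theta>2"] by (simp add: A_def eq_diff_eq add.commute)
    then show ?thesis
      by simp
  qed
  have "smul M r (X (bd M 2 \<theta>2)) + smul M r (bd M 3 (X' \<theta>2)) =
      smul M (r * b0) \<theta>2 - smul M r (\<alpha> 2 (\<beta> 2 \<theta>2))"
    using X_bd[of \<theta>2] by (simp add: M.scale_right_diff_distrib flip: M.scale_right_distrib)
  then have "smul M r (X A) - rmul M a 1 A + \<alpha> 2 B + bd M 3 C = smul M f \<theta>2"
    unfolding XA wA
    by (simp add: B_def C_def alpha_Y alpha_bd bd_w2 f_eq algebra_simps)
  moreover have "- rmul K \<sigma> 2 B + smul K r (\<beta> 3 C) - bd K 4 D = smul K f \<phi>3"
    by (simp add: B_def C_def D_def z_Y beta_adj beta_w beta_alpha beta_bd bd_z3 f_eq algebra_simps)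
  moreover have "- rmul M a 3 C + \<alpha> 4 D = smul M f \<theta>4"
    by (simp add: C_def D_def w3_adj w_w w_alpha w3_bd alpha_beta4 f_eq algebra_simps)
  moreover have "g_od (\<theta>2, \<phi>3, \<theta>4) = (A, B, C, D)"
    by (simp only: g_odd_def A_def B_def C_def D_def prod.case)
  ultimately show ?thesis
    by (simp only: g_even_def prod.case)
qed

abbreviation M31 :: "'m set" where "M31 \<equiv> ann3 M M12"
abbreviation M32 :: "'m set" where "M32 \<equiv> ann3 M M11"

lemma ann3I:
  "\<theta> \<in> gr M 3 \<Longrightarrow> (\<And>x. x \<in> N \<Longrightarrow> mul M 3 1 \<theta> x = 0) \<Longrightarrow> \<theta> \<in> ann3 M N"
  unfolding ann3_def by blast

lemma ann3_mul: "\<theta> \<in> ann3 M N \<Longrightarrow> x \<in> N \<Longrightarrow> mul M 3 1 \<theta> x = 0"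
  unfolding ann3_def by blast

lemma ann3_in: "\<theta> \<in> ann3 M N \<Longrightarrow> \<theta> \<in> gr M 3"
  unfolding ann3_def by blast

lemmas M3_in [simp] = ann3_in[of _ M11] ann3_in[of _ M12]

lemma ann3_subspace:
  assumes "N \<subseteq> gr M 1"
  shows "M.subspace (ann3 M N)"
  unfolding M.subspace_def
proof (intro conjI ballI allI)
  have [simp]: "x \<in> N \<Longrightarrow> x \<in> gr M 1" for x
    using assms by blast
  show "0 \<in> ann3 M N"
    by (rule ann3I) simp_all
  show "x + y \<in> ann3 M N" if "x \<in> ann3 M N" "y \<in> ann3 M N" for x y
    by (rule ann3I) (use that in \<open>simp_all add: ann3_in[OF that(1)] ann3_in[OF that(2)] ann3_mul\<close>)
  show "smul M c x \<in> ann3 M N" if "x \<in> ann3 M N" for c x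
    by (rule ann3I) (use that in \<open>simp_all add: ann3_in[OF that] ann3_mul\<close>)
qed

lemma M3_subspaces: "M.subspace M31" "M.subspace M32"
  by (rule ann3_subspace; auto)+

lemma M3_eqI:
  assumes "x \<in> gr M 3" "y \<in> gr M 3"
    and "\<And>\<theta>. \<theta> \<in> M11 \<Longrightarrow> mul M 3 1 x \<theta> = mul M 3 1 y \<theta>"
    and "\<And>\<theta>. \<theta> \<in> M12 \<Longrightarrow> mul M 3 1 x \<theta> = mul M 3 1 y \<theta>"
  shows "x = y"
proof (rule eq3I[OF assms(1,2)])
  fix \<theta> assume \<theta>: "\<theta> \<in> gr M 1"
  then have "mul M 3 1 x (p1 \<theta> + p2 \<theta>) = mul M 3 1 y (p1 \<theta> + p2 \<theta>)"
    using assms by simp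
  then show "mul M 3 1 x \<theta> = mul M 3 1 y \<theta>"
    using \<theta> by (simp only: p_sum)
qed

text \<open>
  By Poincare duality the decomposition of \<open>M\<^sub>1\<close> induces the dual decomposition of \<open>M\<^sub>3\<close>: the part
  \<open>x\<close> of \<open>\<theta>\<close> in \<open>M\<^sub>3\<^sub>,\<^sub>1\<close> represents the functional \<open>\<theta> \<circ> p1\<close>.
\<close>

lemma sum3: "direct_sum (smul M) (gr M 3) M32 M31"
proof -
  have ex: "\<exists>y\<in>M32. \<exists>x\<in>M31. \<theta> = y + x" if \<theta>: "\<theta> \<in> gr M 3" for \<theta>
  proof -
    have "lin_map (smul M) (gr M 1) (smul M) (gr M 4) (\<lambda>\<theta>1. mul M 3 1 \<theta> (p1 \<theta>1))"
      by (rule lin_mapI) (use \<theta> in \<open>simp_all add: lin_map_add[OF M.lin_map_proj[OF sum]]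
          lin_map_scale[OF M.lin_map_proj[OF sum]]\<close>)
    then have "\<exists>!x. x \<in> gr M 3 \<and> (\<forall>\<theta>1\<in>gr M 1. mul M 3 1 x \<theta>1 = mul M 3 1 \<theta> (p1 \<theta>1))"
      using M.perfect[of 3 1] by (simp add: perfect_pairing_def)
    then obtain x where x: "x \<in> gr M 3"
      "\<And>\<theta>1. \<theta>1 \<in> gr M 1 \<Longrightarrow> mul M 3 1 x \<theta>1 = mul M 3 1 \<theta> (p1 \<theta>1)"
      by blast
    have "x \<in> M31" "\<theta> - x \<in> M32"
      by (rule ann3I; use x \<theta> in \<open>simp add: M.proj_0[OF sum] M.proj_id[OF sum]\<close>)+
    then show ?thesis
      by (intro bexI[of _ "\<theta> - x"] bexI[of _ x]) simp_all
  qed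
  have "\<theta> = 0" if "\<theta> \<in> M32" "\<theta> \<in> M31" for \<theta>
    by (rule M3_eqI) (use that in \<open>simp_all add: ann3_mul\<close>)
  then have "M32 \<inter> M31 = {0}"
    using M3_subspaces[THEN M.subspace_0] by blast
  moreover have "gr M 3 = {y + x | y x. y \<in> M32 \<and> x \<in> M31}"
  proof
    show "gr M 3 \<subseteq> {y + x | y x. y \<in> M32 \<and> x \<in> M31}"
      using ex by blast
  qed auto
  ultimately show ?thesis
    using M3_subspaces unfolding direct_sum_def by blast
qed

abbreviation q2 :: "'m \<Rightarrow> 'm" where "q2 \<equiv> proj M32 M31"

lemma q2_lin: "lin_map (smul M) (gr M 3) (smul M) M32 q2"
  by (rule M.lin_map_proj[OF sum3])

lemma beta_M32: "\<theta> \<in> M32 \<Longrightarrow> \<beta> 3 \<theta> = 0"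
  by (rule beta_eqI[of 3 1]) (simp_all add: ann3_mul ori_zero)

lemma w3_M32: "\<theta> \<in> M32 \<Longrightarrow> rmul M a 3 \<theta> = 0"
  by (simp add: rmul_def ann3_mul)

text \<open>
  The restriction of \<open>\<beta>\<^sub>3\<close> to \<open>M\<^sub>3\<^sub>,\<^sub>1\<close> is the transpose of the isomorphism of \<open>K\<^sub>1\<close> with \<open>M\<^sub>1\<^sub>,\<^sub>1\<close>.
\<close>

lemma beta3_iso: "lin_iso (smul M) M31 (smul K) (gr K 3) (\<beta> 3)"
proof -
  have lin: "lin_map (smul M) M31 (smul K) (gr K 3) (\<beta> 3)"
    by (rule lin_mapI) simp_all
  have "inj_on (\<beta> 3) M31"
  proof (rule inj_onI)
    fix x y assume xy: "x \<in> M31" "y \<in> M31" and eq: "\<beta> 3 x = \<beta> 3 y"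
    show "x = y"
    proof (rule M3_eqI)
      fix \<theta> assume \<theta>: "\<theta> \<in> M11"
      have "oM (mul M 3 1 x (\<alpha> 1 (\<iota>' \<theta>))) = oM (mul M 3 1 y (\<alpha> 1 (\<iota>' \<theta>)))"
        using beta_spec(2)[of 3 1 x "\<iota>' \<theta>"] beta_spec(2)[of 3 1 y "\<iota>' \<theta>"] xy \<theta> eq by simp
      then show "mul M 3 1 x \<theta> = mul M 3 1 y \<theta>"
        using xy \<theta> by (simp add: alpha_iota' M.ori_eq_iff)
    qed (use xy in \<open>simp_all add: ann3_mul\<close>)
  qed
  moreover have "\<psi> \<in> \<beta> 3 ` M31" if \<psi>: "\<psi> \<in> gr K 3" for \<psi>
  proof -
    have "lin_map (smul M) (gr M 1) (*) UNIV (\<lambda>\<theta>. oK (mul K 3 1 \<psi> (\<iota>' (p1 \<theta>))))"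
      by (rule lin_mapI) (use \<psi> in \<open>simp_all add: lin_map_add[OF M.lin_map_proj[OF sum]]
          lin_map_scale[OF M.lin_map_proj[OF sum]] lin_map_add[OF iota'_lin]
          lin_map_scale[OF iota'_lin] lin_map_add[OF K.ori_lin] K.ori_scale\<close>)
    then obtain x where x: "x \<in> gr M 3"
      "\<And>\<theta>. \<theta> \<in> gr M 1 \<Longrightarrow> oM (mul M 3 1 x \<theta>) = oK (mul K 3 1 \<psi> (\<iota>' (p1 \<theta>)))"
      using M.represent[of 3 1] by auto
    have "mul M 3 1 x \<theta> = 0" if "\<theta> \<in> M12" for \<theta>
    proof -
      have "\<iota>' 0 = 0"
        by (rule MK.lin_map_zero[OF iota'_lin M1_subspaces(1)])
      then have "oM (mul M 3 1 x \<theta>) = oM 0"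
        using x that \<psi> by (simp add: M.proj_0[OF sum] ori_zero)
      moreover have "mul M 3 1 x \<theta> \<in> gr M 4"
        using x(1) that by simp
      ultimately show ?thesis
        by (simp only: M.ori_eq_iff M.gr_zero)
    qed
    then have "x \<in> M31"
      using x by (intro ann3I)
    moreover have "\<beta> 3 x = \<psi>"
      by (rule beta_eqI[of 3 1]) (use x \<psi> in \<open>simp_all add: p1_alpha iota'_alpha\<close>)
    ultimately show ?thesis
      by blast
  qed
  ultimately show ?thesis
    using lin by (auto simp: lin_iso_def bij_betw_def)
qed

abbreviation \<rho> :: "'k \<Rightarrow> 'm" where "\<rho> \<equiv> inv_into M31 (\<beta> 3)"

lemma rho_lin: "lin_map (smul K) (gr K 3) (smul M) M31 \<rho>"
  by (rule MK.lin_iso_inv_into[OF beta3_iso M3_subspaces(1)])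

lemma rho_in [simp]: "\<psi> \<in> gr K 3 \<Longrightarrow> \<rho> \<psi> \<in> M31"
  by (rule lin_map_in[OF rho_lin])

lemma beta_rho: "\<psi> \<in> gr K 3 \<Longrightarrow> \<beta> 3 (\<rho> \<psi>) = \<psi>"
  using beta3_iso by (intro f_inv_into_f) (auto simp: lin_iso_def bij_betw_def)

lemma rho_beta: "\<theta> \<in> M31 \<Longrightarrow> \<rho> (\<beta> 3 \<theta>) = \<theta>"
  using beta3_iso by (intro inv_into_f_f) (auto simp: lin_iso_def bij_betw_def)

text \<open>
  As \<open>\<beta>\<^sub>3\<close> kills \<open>M\<^sub>3\<^sub>,\<^sub>2\<close> and \<open>\<rho>\<close> inverts it on \<open>M\<^sub>3\<^sub>,\<^sub>1\<close>, the composite \<open>\<rho> \<circ> \<beta>\<^sub>3\<close> is the projection to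
  \<open>M\<^sub>3\<^sub>,\<^sub>1\<close>.
\<close>

lemma q2_sub:
  assumes "\<theta> \<in> gr M 3"
  shows "\<theta> = q2 \<theta> + \<rho> (\<beta> 3 \<theta>)"
proof -
  obtain y x where yx: "y \<in> M32" "x \<in> M31" "\<theta> = y + x"
    using sum3 assms by (rule M.direct_sumE)
  then have "q2 \<theta> = y"
    by (simp add: M.proj_eqI[OF sum3])
  moreover have "\<beta> 3 \<theta> = \<beta> 3 x"
    using yx by (simp add: beta_M32)
  ultimately show ?thesis
    using yx by (simp add: rho_beta)
qed

context
  fixes s :: 'p
  assumes rs: "r * s = 1"
begin

abbreviation g_ev' :: "'m \<times> 'k \<times> 'm \<Rightarrow> 'm" where
  "g_ev' \<equiv> g_even' K M M12 \<alpha> \<beta> r s \<sigma> X"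
abbreviation g_od' :: "'m \<Rightarrow> 'm \<times> 'k \<times> 'm" where
  "g_od' \<equiv> g_odd' K M M11 M12 \<alpha> \<beta> r \<sigma> X"

text \<open>
  For a unit \<open>r\<close> the small pair sits in the large one.  The correction \<open>r\<^sup>-\<^sup>1 \<rho>(z\<^sub>2 \<phi>\<^sub>2)\<close> of \<open>\<theta>\<^sub>3\<close> is chosen to
  make the component in \<open>K\<^sub>3\<close> vanish, and \<open>r\<^sup>-\<^sup>1 W(\<phi>\<^sub>2)\<close> is its image under \<open>m\<^sub>3\<close>.  The component in \<open>M\<^sub>4\<close>
  then vanishes as well, because \<open>\<beta>\<^sub>4\<close> is injective and \<open>z\<^sub>3 \<circ> z\<^sub>2 = 0\<close>.
\<close>

lemma g_even_reduce:
  assumes "\<theta>1 \<in> M12" and "\<phi>2 \<in> gr K 2" and "\<theta>3 \<in> M32"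
  shows "g_ev (\<theta>1, \<phi>2, \<theta>3 + smul M s (\<rho> (rmul K \<sigma> 2 \<phi>2)), 0) = (g_ev' (\<theta>1, \<phi>2, \<theta>3), 0, 0)"
proof -
  note [simp] = assms
  let ?\<rho> = "\<rho> (rmul K \<sigma> 2 \<phi>2)"
  have \<rho> [simp]: "?\<rho> \<in> M31"
    by simp
  have "rmul M a 3 ?\<rho> = 0"
    by (rule beta4_inj) (simp_all add: beta_w beta_rho z_z)
  then show ?thesis
    by (simp add: g_even_def g_even'_def W_map_def beta_M32 w3_M32 beta_rho rs algebra_simps)
qed

lemma g_odd'_g_even':
  assumes "\<theta>1 \<in> M12" and "\<phi>2 \<in> gr K 2" and "\<theta>3 \<in> M32"
  shows "g_od' (g_ev' (\<theta>1, \<phi>2, \<theta>3)) = (smul M f \<theta>1, smul K f \<phi>2, smul M f \<theta>3)"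
proof -
  let ?\<rho> = "smul M s (\<rho> (rmul K \<sigma> 2 \<phi>2))"
  let ?A = "g_ev' (\<theta>1, \<phi>2, \<theta>3)"
  have \<rho>: "?\<rho> \<in> M31"
    using assms by (intro M.subspace_scale[OF M3_subspaces(1)]) simp
  have "g_od (?A, 0, 0) = (smul M f \<theta>1, smul K f \<phi>2, smul M f (\<theta>3 + ?\<rho>), smul K f 0)"
    unfolding g_even_reduce[OF assms, symmetric] by (rule g_odd_g_even) (use assms \<rho> in simp_all)
  then have "p2 (bd M 2 ?A) = smul M f \<theta>1" and "smul K r (\<beta> 2 ?A) - Y ?A = smul K f \<phi>2"
    and "smul M r (X' ?A) + rmul M a 2 ?A = smul M f (\<theta>3 + ?\<rho>)"
    by (simp_all add: g_odd_def)
  moreover have "q2 (smul M f (\<theta>3 + ?\<rho>)) = smul M f \<theta>3"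
    using assms \<rho> by (simp add: lin_map_scale[OF q2_lin] M.proj_eqI[OF sum3])
  ultimately show ?thesis
    by (simp add: g_odd'_def)
qed

text \<open>
  Conversely, on \<open>(\<theta>\<^sub>2, 0, 0)\<close> the large odd map lands in the subset just described: the component in
  \<open>K\<^sub>3\<close> of the composite is zero, which forces the part of \<open>C\<close> in \<open>M\<^sub>3\<^sub>,\<^sub>1\<close> to be the correction.
\<close>

lemma g_even'_g_odd':
  assumes "\<theta>2 \<in> gr M 2"
  shows "g_ev' (g_od' \<theta>2) = smul M f \<theta>2"
proof -
  note [simp] = assms
  define A where "A = p2 (bd M 2 \<theta>2)"
  define B where "B = smul K r (\<beta> 2 \<theta>2) - Y \<theta>2"
  define C where "C = smul M r (X' \<theta>2) + rmul M a 2 \<theta>2"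
  have [simp]: "A \<in> M12" "B \<in> gr K 2" "C \<in> gr M 3"
    by (simp_all add: A_def B_def C_def)
  have od: "g_od (\<theta>2, 0, 0) = (A, B, C, 0)"
    by (simp add: g_odd_def A_def B_def C_def)
  have ev: "g_ev (A, B, C, 0) = (smul M f \<theta>2, 0, 0)"
    unfolding od[symmetric] by (simp add: g_even_g_odd)
  then have "smul K r (\<beta> 3 C) = rmul K \<sigma> 2 B"
    by (simp add: g_even_def)
  then have "smul K s (smul K r (\<beta> 3 C)) = smul K s (rmul K \<sigma> 2 B)"
    by simp
  then have "\<beta> 3 C = smul K s (rmul K \<sigma> 2 B)"
    using rs by (simp add: mult.commute)
  then have C: "C = q2 C + smul M s (\<rho> (rmul K \<sigma> 2 B))"
    using q2_sub[of C] by (simp add: lin_map_scale[OF rho_lin])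
  have "q2 C \<in> M32"
    by (rule lin_map_in[OF q2_lin]) simp
  then have "g_ev (A, B, C, 0) = (g_ev' (A, B, q2 C), 0, 0)"
    using g_even_reduce[of A B "q2 C"] C by simp
  then show ?thesis
    using ev by (simp add: g_odd'_def A_def B_def C_def)
qed

end

end

lemma module_prod_scale:
  assumes "module s" and "module t"
  shows "module (module_prod.scale s t)"
    and "module_prod.scale s t c (x, y) = (s c x, t c y)"
proof -
  interpret module_prod s t
    by (intro module_prod.intro module_pair.intro assms)
  show "module (module_prod.scale s t)"
    by (rule p.module_axioms)
  show "module_prod.scale s t c (x, y) = (s c x, t c y)"
    by (rule scale_prod)
qed

context linkage_data
begin

lemmas scale_tuple = module_prod_scale M.module_axioms K.module_axioms

lemma matrix_factorization_g:
  "matrix_factorization f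
     (module_prod.scale (smul M)
       (module_prod.scale (smul K) (module_prod.scale (smul M) (smul K))))
     (M12 \<times> gr K 2 \<times> gr M 3 \<times> gr K 4)
     (module_prod.scale (smul M) (module_prod.scale (smul K) (smul M)))
     (gr M 2 \<times> gr K 3 \<times> gr M 4) g_ev g_od"
  unfolding matrix_factorization_def
proof (intro conjI ballI)
  show "lin_map (module_prod.scale (smul M)
       (module_prod.scale (smul K) (module_prod.scale (smul M) (smul K))))
     (M12 \<times> gr K 2 \<times> gr M 3 \<times> gr K 4)
     (module_prod.scale (smul M) (module_prod.scale (smul K) (smul M)))
     (gr M 2 \<times> gr K 3 \<times> gr M 4) g_ev"
    by (rule lin_mapI) (auto simp: g_even_def scale_tuple algebra_simps)
  show "lin_map (module_prod.scale (smul M) (module_prod.scale (smul K) (smul M)))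
     (gr M 2 \<times> gr K 3 \<times> gr M 4)
     (module_prod.scale (smul M)
       (module_prod.scale (smul K) (module_prod.scale (smul M) (smul K))))
     (M12 \<times> gr K 2 \<times> gr M 3 \<times> gr K 4) g_od"
    by (rule lin_mapI) (auto simp: g_odd_def scale_tuple algebra_simps Y_add Y_scale
        lin_map_add[OF M.lin_map_proj[OF sum']] lin_map_scale[OF M.lin_map_proj[OF sum']])
qed (auto simp: g_odd_g_even g_even_g_odd scale_tuple)

lemma matrix_factorization_g':
  assumes rs: "r * s = 1"
  shows "matrix_factorization f
     (module_prod.scale (smul M) (module_prod.scale (smul K) (smul M)))
     (M12 \<times> gr K 2 \<times> M32) (smul M) (gr M 2)
     (g_even' K M M12 \<alpha> \<beta> r s \<sigma> X) (g_odd' K M M11 M12 \<alpha> \<beta> r \<sigma> X)"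
  unfolding matrix_factorization_def
proof (intro conjI ballI)
  have W: "lin_map (smul K) (gr K 2) (smul M) (gr M 2) (W_map K M M12 \<beta> \<sigma>)"
    by (rule lin_mapI)
      (simp_all add: W_map_def lin_map_add[OF rho_lin] lin_map_scale[OF rho_lin])
  show "lin_map (module_prod.scale (smul M) (module_prod.scale (smul K) (smul M)))
     (M12 \<times> gr K 2 \<times> M32) (smul M) (gr M 2) (g_even' K M M12 \<alpha> \<beta> r s \<sigma> X)"
    by (rule lin_mapI) (auto simp: g_even'_def scale_tuple algebra_simps lin_map_in[OF W]
        lin_map_add[OF W] lin_map_scale[OF W])
  show "lin_map (smul M) (gr M 2)
     (module_prod.scale (smul M) (module_prod.scale (smul K) (smul M)))
     (M12 \<times> gr K 2 \<times> M32) (g_odd' K M M11 M12 \<alpha> \<beta> r \<sigma> X)"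
    by (rule lin_mapI) (auto simp: g_odd'_def scale_tuple algebra_simps Y_add Y_scale
        lin_map_add[OF M.lin_map_proj[OF sum']] lin_map_scale[OF M.lin_map_proj[OF sum']]
        lin_map_in[OF q2_lin] lin_map_add[OF q2_lin] lin_map_scale[OF q2_lin]
        M.subspace_add[OF M3_subspaces(2)] M.subspace_scale[OF M3_subspaces(2)])
qed (auto simp: g_odd'_g_even'[OF rs] g_even'_g_odd'[OF rs] scale_tuple)

end

lemma regular_element_hd:
  assumes "regular_sequence as" and "as \<noteq> []"
  shows "regular_element (hd as)"
proof -
  have "\<forall>i<length as. \<forall>p. as ! i * p \<in> module.span (*) (set (take i as)) \<longrightarrow>
      p \<in> module.span (*) (set (take i as))"
    using assms(1) unfolding regular_sequence_def by (rule conjunct1)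
  then have "\<forall>p. as ! 0 * p \<in> module.span (*) (set (take 0 as)) \<longrightarrow>
      p \<in> module.span (*) (set (take 0 as))"
    using assms(2) by (metis length_greater_0_conv)
  then show ?thesis
    using assms(2) by (simp add: module.span_empty[OF module_mult] regular_element_def hd_conv_nth)
qed

theorem theorem3p4:
  fixes f r :: "'p::comm_ring_1" and \<KK> :: "'p set"
    and M :: "('p, 'm::ab_group_add) dgg" and M11 M12 :: "'m set"
    and K :: "('p, 'k::ab_group_add) dgg" and \<sigma> :: 'k
    and oK :: "'k \<Rightarrow> 'p" and oM :: "'m \<Rightarrow> 'p"
    and \<alpha> :: "nat \<Rightarrow> 'k \<Rightarrow> 'm" and X :: "'m \<Rightarrow> 'm"
  \<comment> \<open>the ring, the element and the ideal\<close>
  assumes "noetherian TYPE('p)"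
    and "regular_element f"
    and "\<exists>as. length as = 4 \<and> regular_sequence as \<and> \<KK> = module.span (*) (set as)"
  \<comment> \<open>the resolution M\<close>
    and "dg_gamma_algebra M"
    and "poincare_duality M 4"
    and "resolution_of M (colon \<KK> f)"
    and "direct_sum (smul M) (gr M 1) M11 M12"
    and "free_of_rank (smul M) M11 4"
    and "\<exists>n. free_of_rank (smul M) M12 n"
    and "(\<lambda>x. scalar M (bd M 1 x)) ` M11 = \<KK>"
  \<comment> \<open>the Koszul complex K\<close>
    and "dg_gamma_algebra K"
    and "koszul_complex K 4"
    and "resolution_of K \<KK>"
  \<comment> \<open>orientations\<close>
    and "lin_iso (smul K) (gr K 4) (*) UNIV oK"
    and "lin_iso (smul M) (gr M 4) (*) UNIV oM"
  \<comment> \<open>the maps alpha and beta\<close>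
    and "dgg_hom K M \<alpha>"
    and "lin_iso (smul K) (gr K 1) (smul M) M11 (proj M11 M12 \<circ> \<alpha> 1)"
    and "\<forall>\<phi>\<in>gr K 1. scalar M (bd M 1 (proj M11 M12 (\<alpha> 1 \<phi>))) = scalar K (bd K 1 \<phi>)"
    and "\<forall>\<phi>\<in>gr K 1. proj M12 M11 (\<alpha> 1 \<phi>) = 0"
  defines "\<beta> \<equiv> dual_map K M oK oM \<alpha>"
  defines "b0 \<equiv> scalar K (\<beta> 0 (un M))"
  \<comment> \<open>the further data\<close>
  assumes "\<sigma> \<in> gr K 1"
    and "f = r * b0 + scalar K (bd K 1 \<sigma>)"
  \<comment> \<open>the map X\<close>
    and "lin_map (smul M) (gr M 1) (smul M) (gr M 2) X"
    and a: "\<forall>\<phi>\<in>gr K 1. X (\<alpha> 1 \<phi>) = 0"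
    and b: "\<forall>\<theta>\<in>gr M 1. bd M 2 (X \<theta>) = smul M b0 \<theta> - \<alpha> 1 (\<beta> 1 \<theta>)"
    and c: "\<forall>\<theta>\<in>gr M 2.
              X (bd M 2 \<theta>) + bd M 3 (adjoint_map M X \<theta>) = smul M b0 \<theta> - \<alpha> 2 (\<beta> 2 \<theta>)"
    and d: "\<forall>\<theta>\<in>gr M 1. adjoint_map M X (X \<theta>) = 0"
    and e: "\<forall>\<phi>\<in>gr K 2. adjoint_map M X (\<alpha> 2 \<phi>) = 0"
  shows "matrix_factorization f
           (module_prod.scale (smul M)
             (module_prod.scale (smul K) (module_prod.scale (smul M) (smul K))))
           (M12 \<times> gr K 2 \<times> gr M 3 \<times> gr K 4)
           (module_prod.scale (smul M) (module_prod.scale (smul K) (smul M)))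
           (gr M 2 \<times> gr K 3 \<times> gr M 4)
           (g_even K M \<alpha> \<beta> r \<sigma> X) (g_odd K M M11 M12 \<alpha> \<beta> r \<sigma> X) \<and>
         (\<forall>s. r * s = 1 \<longrightarrow> matrix_factorization f
           (module_prod.scale (smul M) (module_prod.scale (smul K) (smul M)))
           (M12 \<times> gr K 2 \<times> ann3 M M11)
           (smul M)
           (gr M 2)
           (g_even' K M M12 \<alpha> \<beta> r s \<sigma> X) (g_odd' K M M11 M12 \<alpha> \<beta> r \<sigma> X))"
proof -
  interpret M: dg_gamma_algebra M by fact
  interpret K: dg_gamma_algebra K by fact
  interpret K: oriented_dg_algebra K 4 oK
    by unfold_locales (rule koszul_complex_poincare_duality, fact+)
  interpret M: oriented_dg_algebra M 4 oM
    by unfold_locales fact+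
  obtain as where as: "length as = 4" "regular_sequence as" and KK: "\<KK> = module.span (*) (set as)"
    using assms(3) by blast
  have "hd as \<in> \<KK>"
    unfolding KK using as(1) by (intro module.span_base[OF module_mult] hd_in_set) auto
  moreover have img: "(\<lambda>x. scalar K (bd K 1 x)) ` gr K 1 = \<KK>"
    using \<open>resolution_of K \<KK>\<close> unfolding resolution_of_def by (rule conjunct1)
  ultimately have "hd as \<in> (\<lambda>x. scalar K (bd K 1 x)) ` gr K 1"
    by (simp only:)
  then obtain \<phi> where "\<phi> \<in> gr K 1" and \<phi>: "hd as = scalar K (bd K 1 \<phi>)"
    by (rule imageE)
  moreover have "regular_element (hd as)"
    using as by (intro regular_element_hd) auto
  ultimately have reg: "\<exists>\<phi>\<in>gr K 1. regular_element (scalar K (bd K 1 \<phi>))"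
    by auto
  interpret dual_pair K oK M oM \<alpha>
    using \<open>dgg_hom K M \<alpha>\<close> by unfold_locales (simp_all add: dgg_hom_def)
  interpret linkage_data K oK M oM \<alpha> M11 M12 "colon \<KK> f" f r \<sigma> X
    using assms reg by unfold_locales (simp_all only: \<beta>_def b0_def)
  show ?thesis
    unfolding \<beta>_def using matrix_factorization_g matrix_factorization_g' by blast
qed

end
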